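(* Let $m\ge2$, $n\in\mathbb{N}$ and $p\ge1$. Then $$\mathfrak{F}_{p+n}\le\left(\frac{p+n}{4^n p}\prod_{j=1}^n(p+j)\right)^{\frac{1}{p+n}}\mathfrak{F}_p^{\frac{p}{p+n}},\qquad \mathfrak{F}^{\mathrm{convex}}_{p+n}\le\left(\frac{p+n}{4^n p}\prod_{j=1}^n(p+j)\right)^{\frac{1}{p+n}}\big(\mathfrak{F}^{\mathrm{convex}}_p\big)^{\frac{p}{p+n}}.$$ In particular, if $1\le p\le2$ then $\mathfrak{F}_{p+1}\le\left(\frac{(p+1)^2}{4p}\right)^{\frac{1}{p+1}}$.
   Context: For a non-empty open $\Omega\subset\mathbb{R}^m$ with $|\Omega|<\infty$, $\lambda_1(\Omega)=\inf_{\varphi\in H_0^1(\Omega)\setminus\{0\}}\int_\Omega|D\varphi|^2/\int_\Omega\varphi^2$, $v_\Omega$ is the unique solution of $-\Delta v=1$, $v\in H_0^1(\Omega)$, $F_p(\Omega)=\|v_\Omega\|_{L^p(\Omega)}\lambda_1(\Omega)/|\Omega|^{1/p}$ for $1\le p<\infty$. $\mathfrak{F}_p=\sup\{F_p(\Omega):\Omega\text{ open in }\mathbb{R}^m,\ 0<|\Omega|<\infty\}$ and $\mathfrak{F}^{\mathrm{convex}}_p=\sup\{F_p(\Omega):\Omega\text{ open, convex in }\mathbb{R}^m,\ 0<|\Omega|<\infty\}$. *)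

theory Defs
  imports "HOL-Analysis.Analysis"
begin

fun iter_partial :: "'a::euclidean_space list \<Rightarrow> ('a \<Rightarrow> real) \<Rightarrow> 'a \<Rightarrow> real" where
  "iter_partial [] f = f"
| "iter_partial (i # is) f = (\<lambda>x. frechet_derivative (iter_partial is f) (at x) i)"

definition smooth_fun :: "('a::euclidean_space \<Rightarrow> real) \<Rightarrow> bool" where
  "smooth_fun f \<longleftrightarrow>
     (\<forall>is. set is \<subseteq> Basis \<longrightarrow> (\<forall>x. iter_partial is f differentiable (at x)))"

definition test_fun :: "'a::euclidean_space set \<Rightarrow> ('a \<Rightarrow> real) \<Rightarrow> bool" where
  "test_fun \<Omega> \<phi> \<longleftrightarrow> smooth_fun \<phi> \<and> compact (closure {x. \<phi> x \<noteq> 0})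
      \<and> closure {x. \<phi> x \<noteq> 0} \<subseteq> \<Omega>"

definition grad :: "('a::euclidean_space \<Rightarrow> real) \<Rightarrow> 'a \<Rightarrow> 'a" where
  "grad f x = (\<Sum>i\<in>Basis. frechet_derivative f (at x) i *\<^sub>R i)"

text \<open>H01 Omega u G: u belongs to H_0^1(Omega) (closure of C_c-infinity(Omega) in the
H^1 norm, functions extended by zero to the whole space) and G is its weak gradient.\<close>

definition H01 :: "'a::euclidean_space set \<Rightarrow> ('a \<Rightarrow> real) \<Rightarrow> ('a \<Rightarrow> 'a) \<Rightarrow> bool" where
  "H01 \<Omega> u G \<longleftrightarrow>
     u \<in> borel_measurable lebesgue \<and> G \<in> borel_measurable lebesgue \<and>
     integrable lebesgue (\<lambda>x. (u x)\<^sup>2) \<and> integrable lebesgue (\<lambda>x. (norm (G x))\<^sup>2) \<and>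
     (\<exists>\<phi>. (\<forall>k. test_fun \<Omega> (\<phi> k)) \<and>
        (\<lambda>k. LINT x|lebesgue. (\<phi> k x - u x)\<^sup>2) \<longlonglongrightarrow> 0 \<and>
        (\<lambda>k. LINT x|lebesgue. (norm (grad (\<phi> k) x - G x))\<^sup>2) \<longlonglongrightarrow> 0)"

definition lambda1 :: "'a::euclidean_space set \<Rightarrow> real" where
  "lambda1 \<Omega> = Inf {(LINT x|lebesgue. (norm (G x))\<^sup>2) / (LINT x|lebesgue. (u x)\<^sup>2) | u G.
                     H01 \<Omega> u G \<and> (LINT x|lebesgue. (u x)\<^sup>2) \<noteq> 0}"

text \<open>Weak solution of -Delta v = 1, v in H_0^1(Omega); the torsion function
(unique up to null sets).\<close>

definition is_torsion :: "'a::euclidean_space set \<Rightarrow> ('a \<Rightarrow> real) \<Rightarrow> bool" where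
  "is_torsion \<Omega> v \<longleftrightarrow> (\<exists>G. H01 \<Omega> v G \<and>
      (\<forall>\<phi>. test_fun \<Omega> \<phi> \<longrightarrow>
         (LINT x|lebesgue. G x \<bullet> grad \<phi> x) = (LINT x:\<Omega>|lebesgue. \<phi> x)))"

definition torsion :: "'a::euclidean_space set \<Rightarrow> 'a \<Rightarrow> real" where
  "torsion \<Omega> = (SOME v. is_torsion \<Omega> v)"

definition Fp :: "real \<Rightarrow> 'a::euclidean_space set \<Rightarrow> real" where
  "Fp p \<Omega> = (LINT x:\<Omega>|lebesgue. \<bar>torsion \<Omega> x\<bar> powr p) powr (1/p) * lambda1 \<Omega>
              / (measure lebesgue \<Omega>) powr (1/p)"

definition frakF :: "'a::euclidean_space itself \<Rightarrow> real \<Rightarrow> real" where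
  "frakF _ p = Sup {Fp p \<Omega> | \<Omega>::'a set.
       open \<Omega> \<and> 0 < emeasure lebesgue \<Omega> \<and> emeasure lebesgue \<Omega> < \<infinity>}"

definition frakF_convex :: "'a::euclidean_space itself \<Rightarrow> real \<Rightarrow> real" where
  "frakF_convex _ p = Sup {Fp p \<Omega> | \<Omega>::'a set.
       open \<Omega> \<and> convex \<Omega> \<and> 0 < emeasure lebesgue \<Omega> \<and> emeasure lebesgue \<Omega> < \<infinity>}"

end

theory Submission
  imports Defs
begin

text \<open>Write \<open>v\<close> for the torsion function and \<open>\<lambda> = \<lambda>\<^sub>1(\<Omega>)\<close>. Using \<open>|v|\<^bsup>(p+1)/2\<^esup>\<close> as a trial
  function for \<open>\<lambda>\<close> and testing \<open>-\<Delta>v = 1\<close> with \<open>sgn(v)|v|\<^sup>p\<close> gives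
  \<open>\<lambda> \<integral>|v|\<^bsup>p+1\<^esup> \<le> ((p+1)\<^sup>2/4) \<integral>|v|\<^bsup>p-1\<^esup>|Dv|\<^sup>2 \<le> ((p+1)\<^sup>2/(4p)) \<integral>|v|\<^sup>p\<close>,
  and iterating this yields the stated constant. Neither boundedness nor positivity of \<open>v\<close> is
  needed: powers are truncated, and the truncation is removed by Fatou's lemma.
  For \<open>p = 1\<close> the inequality gives \<open>\<lambda>\<^sup>2 \<integral>v\<^sup>2 \<le> |\<Omega>|\<close>, hence \<open>F\<^sub>p \<le> 1\<close> for \<open>1 \<le> p \<le> 2\<close>;
  together with the iteration this also shows that every supremum involved is finite.\<close>

section \<open>Square-integrable functions\<close>

text \<open>\<open>torsion\<close> is a choice and \<open>lambda1\<close> a real infimum. If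
  \<lambda> = 0 then F_p = 0 by its formula. If \<lambda> > 0, the infimum is itself a Poincare
  inequality with constant \<lambda>; it bounds the torsion energy below and so yields a v for the
  choice to pick. The obstacle is that H_0^1 is given only through limits of smooth functions, while
  powers of v are neither smooth nor known to be square integrable. Hence a chain rule is proved for
  C^1 functions with bounded derivative that vanish at 0. Truncated powers fall under it once the
  cut is applied to the derivative instead of the power: for h = min(|t|,k)^a with a = (p-1)/2, the
  primitives g of h and \<psi> of h^2 satisfy |Dg(v)|^2 = Dv . D\<psi>(v) pointwise, so the gradient
  disappears between the two inequalities at every level k. The constants multiply along p, p+1, ...
  because \<lambda>^p times the p-th moment, divided by |\<Omega>|, is F_p^p.\<close>

lemma integrable_fatou_bound:
  fixes f :: "nat \<Rightarrow> 'a \<Rightarrow> real"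
  assumes f: "\<And>n. integrable M (f n)" and nonneg: "\<And>n x. 0 \<le> f n x"
    and bound: "\<forall>\<^sub>F n in sequentially. (LINT x|M. f n x) \<le> C"
    and [measurable]: "g \<in> borel_measurable M"
    and lim: "AE x in M. (\<lambda>n. f n x) \<longlonglongrightarrow> g x"
  shows "integrable M g" and "(LINT x|M. g x) \<le> C"
proof -
  have g0: "AE x in M. 0 \<le> g x"
    using lim by eventually_elim (auto intro: LIMSEQ_le_const nonneg)
  \<comment> \<open>\<open>ennreal\<close> sends negative reals to 0, so the final comparison can be
    read back in the reals only for 0 \<le> C.\<close>
  have C0: "0 \<le> C"
  proof -
    obtain n where "(LINT x|M. f n x) \<le> C"
      using bound by (auto simp: eventually_sequentially)
    moreover have "0 \<le> (LINT x|M. f n x)"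
      by (simp add: nonneg)
    ultimately show ?thesis by simp
  qed
  have [measurable]: "f n \<in> borel_measurable M" for n
    using f by auto
  have "(\<integral>\<^sup>+x. ennreal (g x) \<partial>M) = (\<integral>\<^sup>+x. liminf (\<lambda>n. ennreal (f n x)) \<partial>M)"
  proof (rule nn_integral_cong_AE)
    show "AE x in M. ennreal (g x) = liminf (\<lambda>n. ennreal (f n x))"
      using lim
    proof eventually_elim
      case (elim x)
      then have "(\<lambda>n. ennreal (f n x)) \<longlonglongrightarrow> ennreal (g x)"
        by (intro tendsto_ennrealI)
      then show ?case
        by (simp add: lim_imp_Liminf)
    qed
  qed
  also have "\<dots> \<le> liminf (\<lambda>n. \<integral>\<^sup>+x. ennreal (f n x) \<partial>M)"
    by (intro nn_integral_liminf) auto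
  also have "\<dots> = liminf (\<lambda>n. ennreal (LINT x|M. f n x))"
    by (simp add: nn_integral_eq_integral f nonneg)
  also have "\<dots> \<le> ennreal C"
  proof -
    have "\<forall>\<^sub>F n in sequentially. ennreal (LINT x|M. f n x) \<le> ennreal C"
      using bound by eventually_elim (rule ennreal_leI)
    then have "limsup (\<lambda>n. ennreal (LINT x|M. f n x)) \<le> ennreal C"
      by (rule Limsup_bounded)
    then show ?thesis
      using Liminf_le_Limsup[OF trivial_limit_sequentially] order_trans by blast
  qed
  finally have le: "(\<integral>\<^sup>+x. ennreal (g x) \<partial>M) \<le> ennreal C" .
  then have fin: "(\<integral>\<^sup>+x. ennreal (g x) \<partial>M) < \<infinity>"
    by (rule le_less_trans) simp
  show "integrable M g"
    by (rule integrableI_nonneg[OF _ g0 fin]) measurable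
  have "ennreal (LINT x|M. g x) = (\<integral>\<^sup>+x. ennreal (g x) \<partial>M)"
    by (rule nn_integral_eq_integral[OF \<open>integrable M g\<close> g0, symmetric])
  with le have "ennreal (LINT x|M. g x) \<le> ennreal C"
    by simp
  then show "(LINT x|M. g x) \<le> C"
    using C0 by (simp only: ennreal_le_iff)
qed

text \<open>The norm form covers scalar functions and their vector-valued gradients alike, so each
  L^2 fact is proved once.\<close>

definition square_integrable :: "'a measure \<Rightarrow> ('a \<Rightarrow> 'b::euclidean_space) \<Rightarrow> bool" where
  "square_integrable M f \<longleftrightarrow>
     f \<in> borel_measurable M \<and> integrable M (\<lambda>x. (norm (f x))\<^sup>2)"

lemma square_integrable_measurable:
  "square_integrable M f \<Longrightarrow> f \<in> borel_measurable M"
  by (simp add: square_integrable_def)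

lemma square_integrable_integrable:
  "square_integrable M f \<Longrightarrow> integrable M (\<lambda>x. (norm (f x))\<^sup>2)"
  by (simp add: square_integrable_def)

lemma square_integrable_bound:
  assumes "integrable M w" "f \<in> borel_measurable M" "AE x in M. (norm (f x))\<^sup>2 \<le> w x"
  shows "square_integrable M f"
proof -
  have "integrable M (\<lambda>x. (norm (f x))\<^sup>2)"
    by (rule Bochner_Integration.integrable_bound[OF assms(1)]) (use assms(2,3) in auto)
  then show ?thesis
    using assms(2) by (simp add: square_integrable_def)
qed

lemma norm_add_square_le:
  fixes a b :: "'b::real_inner"
  shows "(norm (a + b))\<^sup>2 \<le> 2 * (norm a)\<^sup>2 + 2 * (norm b)\<^sup>2"
proof -
  have "(norm (a + b))\<^sup>2 + (norm (a - b))\<^sup>2 = 2 * (norm a)\<^sup>2 + 2 * (norm b)\<^sup>2"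
    by (simp add: power2_norm_eq_inner inner_simps)
  then show ?thesis
    by (smt (verit) zero_le_power2)
qed

lemma square_integrable_add:
  assumes "square_integrable M f" "square_integrable M g"
  shows "square_integrable M (\<lambda>x. f x + g x)"
proof (rule square_integrable_bound)
  show "integrable M (\<lambda>x. 2 * (norm (f x))\<^sup>2 + 2 * (norm (g x))\<^sup>2)"
    using assms by (auto simp: square_integrable_def)
qed (use assms norm_add_square_le in \<open>auto simp: square_integrable_def\<close>)

lemma square_integrable_scaleR:
  assumes "square_integrable M f"
  shows "square_integrable M (\<lambda>x. c *\<^sub>R f x)"
  using assms by (auto simp: square_integrable_def power_mult_distrib)

lemma square_integrable_diff:
  assumes "square_integrable M f" "square_integrable M g"
  shows "square_integrable M (\<lambda>x. f x - g x)"
  using square_integrable_add[OF assms(1) square_integrable_scaleR[OF assms(2), of "-1"]]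
  by simp

lemma square_integrable_inner:
  assumes "square_integrable M f" "square_integrable M g"
  shows "integrable M (\<lambda>x. f x \<bullet> g x)"
proof (rule Bochner_Integration.integrable_bound)
  show "integrable M (\<lambda>x. (norm (f x))\<^sup>2 + (norm (g x))\<^sup>2)"
    using assms by (auto simp: square_integrable_def)
  show "(\<lambda>x. f x \<bullet> g x) \<in> borel_measurable M"
    using assms by (auto simp: square_integrable_def)
  show "AE x in M. norm (f x \<bullet> g x) \<le> norm ((norm (f x))\<^sup>2 + (norm (g x))\<^sup>2)"
  proof (rule AE_I2)
    fix x
    have "\<bar>f x \<bullet> g x\<bar> \<le> norm (f x) * norm (g x)"
      by (rule Cauchy_Schwarz_ineq2)
    also have "\<dots> \<le> (norm (f x))\<^sup>2 + (norm (g x))\<^sup>2"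
      using sum_squares_bound[of "norm (f x)" "norm (g x)"]
        mult_nonneg_nonneg[OF norm_ge_zero[of "f x"] norm_ge_zero[of "g x"]] by linarith
    finally show "norm (f x \<bullet> g x) \<le> norm ((norm (f x))\<^sup>2 + (norm (g x))\<^sup>2)"
      by simp
  qed
qed

lemma integral_norm_add_scaleR_square:
  assumes "square_integrable M f" "square_integrable M g"
  shows "(LINT x|M. (norm (f x + t *\<^sub>R g x))\<^sup>2)
    = (LINT x|M. (norm (f x))\<^sup>2) + 2 * t * (LINT x|M. f x \<bullet> g x) + t\<^sup>2 * (LINT x|M. (norm (g x))\<^sup>2)"
proof -
  have "(norm (f x + t *\<^sub>R g x))\<^sup>2 = (norm (f x))\<^sup>2 + 2 * t * (f x \<bullet> g x) + t\<^sup>2 * (norm (g x))\<^sup>2" for x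
    unfolding power2_norm_eq_inner by (simp add: inner_simps inner_commute power2_eq_square algebra_simps)
  then show ?thesis
    using assms square_integrable_inner[OF assms]
    by (simp add: square_integrable_integrable)
qed

text \<open>The integral of |f + t g|^2 is a nonnegative quadratic in t. At t = -b/c this is the
  claim; for c = 0 it is affine and must be constant, since t = -(a + 1)/(2b) would give the value
  -1.\<close>

lemma integral_Cauchy_Schwarz:
  assumes f: "square_integrable M f" and g: "square_integrable M g"
  shows "(LINT x|M. f x \<bullet> g x)\<^sup>2 \<le> (LINT x|M. (norm (f x))\<^sup>2) * (LINT x|M. (norm (g x))\<^sup>2)"
proof -
  define a b c where "a = (LINT x|M. (norm (f x))\<^sup>2)" and "b = (LINT x|M. f x \<bullet> g x)"
    and "c = (LINT x|M. (norm (g x))\<^sup>2)"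
  have q: "0 \<le> a + 2 * t * b + t\<^sup>2 * c" for t
    unfolding a_def b_def c_def integral_norm_add_scaleR_square[OF f g, symmetric] by simp
  have c0: "0 \<le> c" "0 \<le> a"
    by (simp_all add: c_def a_def)
  have "b\<^sup>2 \<le> a * c"
  proof (cases "c = 0")
    case True
    have "b = 0"
    proof (rule ccontr)
      assume "b \<noteq> 0"
      with q[of "- (a + 1) / (2 * b)"] True show False
        by (simp add: field_simps)
    qed
    then show ?thesis using True by simp
  next
    case False
    with c0 have "c > 0" by simp
    with q[of "- b / c"] show ?thesis
      by (simp add: field_simps power2_eq_square)
  qed
  then show ?thesis
    by (simp add: a_def b_def c_def)
qed

lemma tendsto_square_zeroD:
  fixes f :: "'a \<Rightarrow> real"
  assumes "((\<lambda>x. (f x)\<^sup>2) \<longlongrightarrow> 0) F"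
  shows "(f \<longlongrightarrow> 0) F"
  using tendsto_real_sqrt[OF assms] by (simp add: tendsto_rabs_zero_iff)

text \<open>Cauchy-Schwarz applied to \<open>f k - F\<close>. This carries pairings with a fixed
  function, in particular the weak equation, to L^2 limits.\<close>

lemma integral_inner_tendsto:
  assumes f: "\<And>k. square_integrable M (f k)" and F: "square_integrable M F"
    and g: "square_integrable M g"
    and lim: "(\<lambda>k. LINT x|M. (norm (f k x - F x))\<^sup>2) \<longlonglongrightarrow> 0"
  shows "(\<lambda>k. LINT x|M. f k x \<bullet> g x) \<longlonglongrightarrow> (LINT x|M. F x \<bullet> g x)"
proof -
  have le: "(LINT x|M. (f k x - F x) \<bullet> g x)\<^sup>2
      \<le> (LINT x|M. (norm (f k x - F x))\<^sup>2) * (LINT x|M. (norm (g x))\<^sup>2)" for k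
    by (intro integral_Cauchy_Schwarz square_integrable_diff f F g)
  have "(\<lambda>k. (LINT x|M. (f k x - F x) \<bullet> g x)\<^sup>2) \<longlonglongrightarrow> 0"
    by (rule tendsto_sandwich[OF _ _ tendsto_const tendsto_mult_left_zero[OF lim]])
      (use le in \<open>auto intro!: always_eventually\<close>)
  then have "(\<lambda>k. LINT x|M. (f k x - F x) \<bullet> g x) \<longlonglongrightarrow> 0"
    by (rule tendsto_square_zeroD)
  moreover have "(LINT x|M. (f k x - F x) \<bullet> g x) = (LINT x|M. f k x \<bullet> g x) - (LINT x|M. F x \<bullet> g x)" for k
    by (simp add: inner_diff_left square_integrable_inner f F g)
  ultimately show ?thesis
    by (simp add: LIM_zero_iff)
qed

lemma integral_norm_add_square_le:
  assumes "square_integrable M f" "square_integrable M g"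
  shows "(LINT x|M. (norm (f x + g x))\<^sup>2)
    \<le> 2 * (LINT x|M. (norm (f x))\<^sup>2) + 2 * (LINT x|M. (norm (g x))\<^sup>2)"
proof -
  have "(LINT x|M. (norm (f x + g x))\<^sup>2) \<le> (LINT x|M. 2 * (norm (f x))\<^sup>2 + 2 * (norm (g x))\<^sup>2)"
    using assms
    by (intro integral_mono square_integrable_integrable square_integrable_add norm_add_square_le)
      (auto simp: square_integrable_def)
  then show ?thesis
    using assms by (simp add: square_integrable_def)
qed

section \<open>Almost everywhere convergence and completeness in L^2\<close>

lemma AE_subseq_of_L2_tendsto:
  fixes f :: "nat \<Rightarrow> 'a \<Rightarrow> 'b::euclidean_space"
  assumes f: "\<And>k. square_integrable M (f k)" and F: "square_integrable M F"
    and lim: "(\<lambda>k. LINT x|M. (norm (f k x - F x))\<^sup>2) \<longlonglongrightarrow> 0"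
  obtains r :: "nat \<Rightarrow> nat" where "strict_mono r" "AE x in M. (\<lambda>k. f (r k) x) \<longlonglongrightarrow> F x"
proof -
  have "\<exists>r::nat\<Rightarrow>nat. strict_mono r \<and> (AE x in M. (\<lambda>n. (norm (f (r n) x - F x))\<^sup>2) \<longlonglongrightarrow> 0)"
    by (rule tendsto_L1_AE_subseq)
      (use lim f F in \<open>auto intro!: square_integrable_integrable square_integrable_diff\<close>)
  then obtain r :: "nat \<Rightarrow> nat" where r: "strict_mono r"
    and ae: "AE x in M. (\<lambda>n. (norm (f (r n) x - F x))\<^sup>2) \<longlonglongrightarrow> 0"
    by blast
  have "AE x in M. (\<lambda>k. f (r k) x) \<longlonglongrightarrow> F x"
    using ae
  proof eventually_elim
    case (elim x)
    then have "(\<lambda>n. norm (f (r n) x - F x)) \<longlonglongrightarrow> 0"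
      by (rule tendsto_square_zeroD)
    then show ?case
      by (simp add: tendsto_norm_zero_iff LIM_zero_iff)
  qed
  with r show ?thesis by (rule that)
qed

lemma square_integrable_indicator:
  assumes "S \<in> sets M" "emeasure M S < \<infinity>"
  shows "square_integrable M (indicator S :: 'a \<Rightarrow> real)"
    and "(LINT x|M. (norm (indicator S x :: real))\<^sup>2) = measure M S"
proof -
  have ind: "integrable M (indicator S :: 'a \<Rightarrow> real)"
    using assms by (simp add: integrable_indicator_iff less_top)
  show "square_integrable M (indicator S :: 'a \<Rightarrow> real)"
    by (rule square_integrable_bound[OF ind]) (use assms in \<open>auto simp: indicator_def\<close>)
  have "(LINT x|M. (norm (indicator S x :: real))\<^sup>2) = (LINT x|M. (indicator S x :: real))"
    by (intro Bochner_Integration.integral_cong) (auto simp: indicator_def)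
  then show "(LINT x|M. (norm (indicator S x :: real))\<^sup>2) = measure M S"
    using assms sets.sets_into_space[OF assms(1)] by (simp add: Int_absorb1 Int_absorb2)
qed

text \<open>The sequence lives on a set of finite measure, so that an \<open>L\<^sup>2\<close>-Cauchy sequence
  is also \<open>L\<^sup>1\<close>-Cauchy.\<close>

lemma L2_complete_finite_support:
  fixes f :: "nat \<Rightarrow> 'a \<Rightarrow> 'b::euclidean_space"
  assumes f: "\<And>k. square_integrable M (f k)"
    and S: "S \<in> sets M" "emeasure M S < \<infinity>" and supp: "\<And>k x. x \<notin> S \<Longrightarrow> f k x = 0"
    and cauchy: "\<And>e. e > 0 \<Longrightarrow> \<exists>N. \<forall>i\<ge>N. \<forall>j\<ge>N. (LINT x|M. (norm (f i x - f j x))\<^sup>2) < e"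
  obtains F where "square_integrable M F" "(\<lambda>k. LINT x|M. (norm (f k x - F x))\<^sup>2) \<longlonglongrightarrow> 0"
proof -
  note indsq = square_integrable_indicator[OF S]
  have prod: "(indicator S x :: real) \<bullet> norm (f i x - f j x) = norm (f i x - f j x)" for x i j
    using supp[of x i] supp[of x j] by (cases "x \<in> S") auto
  have nsq: "square_integrable M (\<lambda>x. norm (f i x - f j x))" for i j
    using square_integrable_diff[OF f f, of i j] unfolding square_integrable_def by auto
  have nsq1: "square_integrable M (\<lambda>x. norm (f i x))" for i
    using f[of i] unfolding square_integrable_def by auto
  have int1: "integrable M (f i)" for i
  proof -
    have eq: "(indicator S x :: real) \<bullet> norm (f i x) = norm (f i x)" for x
      using supp[of x i] by (cases "x \<in> S") auto
    have "integrable M (\<lambda>x. norm (f i x))"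
      using square_integrable_inner[OF indsq(1) nsq1, of i] unfolding eq .
    then show ?thesis
      using f[of i] by (simp add: integrable_norm_iff square_integrable_def)
  qed
  have L1: "(LINT x|M. norm (f i x - f j x))\<^sup>2
      \<le> measure M S * (LINT x|M. (norm (f i x - f j x))\<^sup>2)" for i j
    using integral_Cauchy_Schwarz[OF indsq(1) nsq, of i j] unfolding prod indsq(2) by simp
  have L1cauchy: "\<exists>N. \<forall>i\<ge>N. \<forall>j\<ge>N. LINT x|M. norm (f i x - f j x) < e" if "e > 0" for e :: real
  proof -
    \<comment> \<open>The \<open>+ 1\<close> keeps the tolerance positive when S is null, where
      division by 0 would give 0.\<close>
    have "e\<^sup>2 / (measure M S + 1) > 0"
      using that by (intro divide_pos_pos zero_less_power add_nonneg_pos) auto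
    then obtain N where N: "\<forall>i\<ge>N. \<forall>j\<ge>N. (LINT x|M. (norm (f i x - f j x))\<^sup>2) < e\<^sup>2 / (measure M S + 1)"
      using cauchy by blast
    have "(LINT x|M. norm (f i x - f j x)) < e" if ij: "i \<ge> N" "j \<ge> N" for i j
    proof -
      define q where "q = (LINT x|M. (norm (f i x - f j x))\<^sup>2)"
      have q: "0 \<le> q" "q < e\<^sup>2 / (measure M S + 1)"
        using N ij by (auto simp: q_def)
      have "(LINT x|M. norm (f i x - f j x))\<^sup>2 \<le> measure M S * q"
        using L1 by (simp add: q_def)
      also have "\<dots> \<le> (measure M S + 1) * q"
        using q by (intro mult_right_mono) auto
      also have "\<dots> < e\<^sup>2"
        using q(2) by (simp add: pos_less_divide_eq add_nonneg_pos mult.commute)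
      finally show ?thesis
        using \<open>e > 0\<close> power2_less_imp_less by fastforce
    qed
    then show ?thesis by blast
  qed
  \<comment> \<open>L^1 theory supplies the candidate limit; convergence in L^2 is recovered below
    by Fatou with one index fixed.\<close>
  obtain r where r: "strict_mono r" "AE x in M. Cauchy (\<lambda>i. f (r i) x)"
    using cauchy_L1_AE_cauchy_subseq[OF int1 L1cauchy] by blast
  define F where "F x = lim (\<lambda>i. f (r i) x)" for x
  have [measurable]: "f i \<in> borel_measurable M" for i
    using f by (simp add: square_integrable_def)
  have [measurable]: "F \<in> borel_measurable M"
    unfolding F_def by measurable
  have lim: "AE x in M. (\<lambda>i. f (r i) x) \<longlonglongrightarrow> F x"
    using r(2) by eventually_elim (simp add: F_def Cauchy_convergent_iff convergent_LIMSEQ_iff)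
  have key: "integrable M (\<lambda>x. (norm (f k x - F x))\<^sup>2) \<and> (LINT x|M. (norm (f k x - F x))\<^sup>2) \<le> e"
    if N: "\<forall>i\<ge>N. \<forall>j\<ge>N. (LINT x|M. (norm (f i x - f j x))\<^sup>2) < e" and "k \<ge> N" for N k e
  proof -
    have ev: "\<forall>\<^sub>F n in sequentially. (LINT x|M. (norm (f k x - f (r n) x))\<^sup>2) \<le> e"
      unfolding eventually_sequentially
    proof (intro exI allI impI)
      fix n assume "N \<le> n"
      then have "N \<le> r n"
        using seq_suble[OF r(1), of n] by simp
      then show "(LINT x|M. (norm (f k x - f (r n) x))\<^sup>2) \<le> e"
        using N \<open>k \<ge> N\<close> by (simp add: less_imp_le)
    qed
    have ae: "AE x in M. (\<lambda>n. (norm (f k x - f (r n) x))\<^sup>2) \<longlonglongrightarrow> (norm (f k x - F x))\<^sup>2"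
      using lim by eventually_elim (intro tendsto_intros)
    have int: "integrable M (\<lambda>x. (norm (f k x - f (r n) x))\<^sup>2)" for n
      by (intro square_integrable_integrable square_integrable_diff f)
    have meas: "(\<lambda>x. (norm (f k x - F x))\<^sup>2) \<in> borel_measurable M"
      by measurable
    show ?thesis
      using integrable_fatou_bound[OF int zero_le_power2 ev meas ae] by (rule conjI)
  qed
  obtain N1 where N1: "\<forall>i\<ge>N1. \<forall>j\<ge>N1. (LINT x|M. (norm (f i x - f j x))\<^sup>2) < 1"
    using cauchy[of 1] by auto
  have "square_integrable M (\<lambda>x. f N1 x - F x)"
    using key[OF N1, of N1] by (simp add: square_integrable_def)
  from square_integrable_diff[OF f[of N1] this] have F: "square_integrable M F"
    by simp
  have "(\<lambda>k. LINT x|M. (norm (f k x - F x))\<^sup>2) \<longlonglongrightarrow> 0"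
  proof (rule LIMSEQ_I)
    fix e :: real assume "e > 0"
    then obtain N where N: "\<forall>i\<ge>N. \<forall>j\<ge>N. (LINT x|M. (norm (f i x - f j x))\<^sup>2) < e / 2"
      using cauchy[of "e/2"] by auto
    have "norm ((LINT x|M. (norm (f k x - F x))\<^sup>2) - 0) < e" if "k \<ge> N" for k
      using key[OF N that] \<open>e > 0\<close> by simp
    then show "\<exists>no. \<forall>n\<ge>no. norm ((LINT x|M. (norm (f n x - F x))\<^sup>2) - 0) < e"
      by blast
  qed
  with F show ?thesis by (rule that)
qed

section \<open>Smooth functions and test functions\<close>

text \<open>Cuts the lists of directions at length n, which allows induction on the order of
  differentiation.\<close>

definition smooth_upto :: "nat \<Rightarrow> ('a::euclidean_space \<Rightarrow> real) \<Rightarrow> bool" where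
  "smooth_upto n f \<longleftrightarrow>
     (\<forall>is. set is \<subseteq> Basis \<longrightarrow> length is \<le> n \<longrightarrow> (\<forall>x. iter_partial is f differentiable (at x)))"

lemma smooth_fun_iff_smooth_upto: "smooth_fun f \<longleftrightarrow> (\<forall>n. smooth_upto n f)"
  unfolding smooth_fun_def smooth_upto_def by blast

text \<open>The head of the list is the outermost derivative, so peeling off the innermost one, as
  recursion on the order requires, means removing the last entry.\<close>

lemma iter_partial_snoc:
  "iter_partial (is @ [i]) f = iter_partial is (\<lambda>x. frechet_derivative f (at x) i)"
  by (induction "is") auto

lemma smooth_upto_Suc:
  "smooth_upto (Suc n) f \<longleftrightarrow>
     (\<forall>x. f differentiable (at x)) \<and>
     (\<forall>i\<in>Basis. smooth_upto n (\<lambda>x. frechet_derivative f (at x) i))"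
  (is "?L \<longleftrightarrow> ?R")
proof
  assume L: ?L
  have "f differentiable (at x)" for x
    using L[unfolded smooth_upto_def, rule_format, of "[]" x] by simp
  moreover have "smooth_upto n (\<lambda>x. frechet_derivative f (at x) i)" if "i \<in> Basis" for i
    unfolding smooth_upto_def
  proof (intro allI impI)
    fix "is" :: "'a list" and x
    assume "set is \<subseteq> Basis" "length is \<le> n"
    then show "iter_partial is (\<lambda>x. frechet_derivative f (at x) i) differentiable (at x)"
      using L[unfolded smooth_upto_def, rule_format, of "is @ [i]" x] that
      by (simp add: iter_partial_snoc)
  qed
  ultimately show ?R by blast
next
  assume R: ?R
  show ?L
    unfolding smooth_upto_def
  proof (intro allI impI)
    fix "is" :: "'a list" and x
    assume *: "set is \<subseteq> Basis" "length is \<le> Suc n"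
    show "iter_partial is f differentiable (at x)"
    proof (cases "is" rule: rev_cases)
      case Nil
      then show ?thesis using R by simp
    next
      case (snoc js i)
      then show ?thesis
        using R * unfolding smooth_upto_def by (auto simp: iter_partial_snoc)
    qed
  qed
qed

lemma smooth_upto_SucD: "smooth_upto (Suc n) f \<Longrightarrow> smooth_upto n f"
  by (auto simp: smooth_upto_def)

lemma smooth_upto_0: "smooth_upto 0 f \<longleftrightarrow> (\<forall>x. f differentiable (at x))"
  by (auto simp: smooth_upto_def)

lemma frechet_derivative_add_fun:
  fixes f g :: "'a::euclidean_space \<Rightarrow> real"
  assumes "f differentiable (at x)" "g differentiable (at x)"
  shows "frechet_derivative (\<lambda>x. f x + g x) (at x) i
    = frechet_derivative f (at x) i + frechet_derivative g (at x) i"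
  by (rule frechet_derivative_at[OF has_derivative_add[OF assms[unfolded frechet_derivative_works]],
        symmetric, THEN fun_cong])

lemma frechet_derivative_mult_fun:
  fixes f g :: "'a::euclidean_space \<Rightarrow> real"
  assumes "f differentiable (at x)" "g differentiable (at x)"
  shows "frechet_derivative (\<lambda>x. f x * g x) (at x) i
    = f x * frechet_derivative g (at x) i + frechet_derivative f (at x) i * g x"
  by (rule frechet_derivative_at[OF has_derivative_mult[OF assms[unfolded frechet_derivative_works]],
        symmetric, THEN fun_cong])

lemma smooth_upto_const: "smooth_upto n (\<lambda>x. c)"
  by (induction n arbitrary: c) (auto simp: smooth_upto_0 smooth_upto_Suc)

lemma smooth_upto_add:
  "smooth_upto n f \<Longrightarrow> smooth_upto n g \<Longrightarrow> smooth_upto n (\<lambda>x. f x + g x)"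
proof (induction n arbitrary: f g)
  case 0
  then show ?case by (auto simp: smooth_upto_0)
next
  case (Suc n)
  then show ?case by (auto simp: smooth_upto_Suc frechet_derivative_add_fun)
qed

lemma smooth_upto_mult:
  "smooth_upto n f \<Longrightarrow> smooth_upto n g \<Longrightarrow> smooth_upto n (\<lambda>x. f x * g x)"
proof (induction n arbitrary: f g)
  case 0
  then show ?case by (auto simp: smooth_upto_0)
next
  case (Suc n)
  have "smooth_upto n f" "smooth_upto n g"
    using Suc.prems by (auto intro: smooth_upto_SucD)
  with Suc show ?case
    by (auto simp: smooth_upto_Suc frechet_derivative_mult_fun intro!: smooth_upto_add)
qed

lemma smooth_fun_const: "smooth_fun (\<lambda>x. c)"
  and smooth_fun_add: "smooth_fun f \<Longrightarrow> smooth_fun g \<Longrightarrow> smooth_fun (\<lambda>x. f x + g x)"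
  and smooth_fun_mult: "smooth_fun f \<Longrightarrow> smooth_fun g \<Longrightarrow> smooth_fun (\<lambda>x. f x * g x)"
  by (simp_all add: smooth_fun_iff_smooth_upto smooth_upto_const smooth_upto_add smooth_upto_mult)

lemma smooth_fun_differentiable: "smooth_fun f \<Longrightarrow> f differentiable (at x)"
  using smooth_upto_0 smooth_fun_iff_smooth_upto by blast

lemma smooth_fun_partial:
  "smooth_fun f \<Longrightarrow> i \<in> Basis \<Longrightarrow> smooth_fun (\<lambda>x. frechet_derivative f (at x) i)"
  unfolding smooth_fun_iff_smooth_upto by (metis smooth_upto_Suc)

lemma smooth_fun_continuous: "smooth_fun f \<Longrightarrow> continuous_on UNIV f"
  by (auto simp: continuous_on_eq_continuous_within
      intro!: differentiable_imp_continuous_within smooth_fun_differentiable)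

lemma smooth_fun_continuous_grad: "smooth_fun f \<Longrightarrow> continuous_on UNIV (grad f)"
  unfolding grad_def[abs_def]
  by (intro continuous_intros smooth_fun_continuous smooth_fun_partial)

lemma test_fun_smooth: "test_fun \<Omega> \<phi> \<Longrightarrow> smooth_fun \<phi>"
  by (simp add: test_fun_def)

text \<open>The support can only shrink; applied to products with \<phi> and to polynomials in
  \<phi>.\<close>

lemma test_fun_of_vanishing:
  assumes "test_fun \<Omega> \<phi>" "smooth_fun \<psi>" "\<And>x. \<phi> x = 0 \<Longrightarrow> \<psi> x = 0"
  shows "test_fun \<Omega> \<psi>"
proof -
  have sub: "{x. \<psi> x \<noteq> 0} \<subseteq> {x. \<phi> x \<noteq> 0}"
    using assms(3) by auto
  have "closure {x. \<psi> x \<noteq> 0} \<subseteq> \<Omega>"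
    using closure_mono[OF sub] assms(1) by (auto simp: test_fun_def)
  moreover have "bounded {x. \<psi> x \<noteq> 0}"
    using sub assms(1) bounded_subset by (auto simp: test_fun_def compact_closure)
  ultimately show ?thesis
    using assms(2) by (simp add: test_fun_def compact_closure)
qed

lemma test_fun_add:
  assumes "test_fun \<Omega> \<phi>" "test_fun \<Omega> \<psi>"
  shows "test_fun \<Omega> (\<lambda>x. \<phi> x + \<psi> x)"
proof -
  have sub: "{x. \<phi> x + \<psi> x \<noteq> 0} \<subseteq> {x. \<phi> x \<noteq> 0} \<union> {x. \<psi> x \<noteq> 0}"
    by auto
  have "bounded ({x. \<phi> x \<noteq> 0} \<union> {x. \<psi> x \<noteq> 0})"
    using assms by (simp add: test_fun_def compact_closure)
  then have "bounded {x. \<phi> x + \<psi> x \<noteq> 0}"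
    using sub by (rule bounded_subset)
  moreover have "closure {x. \<phi> x + \<psi> x \<noteq> 0} \<subseteq> \<Omega>"
    using closure_mono[OF sub] assms unfolding closure_Un by (auto simp: test_fun_def)
  ultimately show ?thesis
    using assms by (simp add: test_fun_def compact_closure smooth_fun_add)
qed

lemma test_fun_mult_left:
  assumes "test_fun \<Omega> \<phi>" "smooth_fun f"
  shows "test_fun \<Omega> (\<lambda>x. f x * \<phi> x)"
  by (rule test_fun_of_vanishing[OF assms(1)])
    (auto intro: smooth_fun_mult assms(2) test_fun_smooth[OF assms(1)])

lemma test_fun_cmult: "test_fun \<Omega> \<phi> \<Longrightarrow> test_fun \<Omega> (\<lambda>x. c * \<phi> x)"
  by (intro test_fun_mult_left smooth_fun_const)

lemma test_fun_zero: "test_fun \<Omega> (\<lambda>x. 0)"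
  by (simp add: test_fun_def smooth_fun_const)

section \<open>Gradients, and integrability of test functions\<close>

lemma grad_has_derivative:
  fixes f :: "'a::euclidean_space \<Rightarrow> real"
  assumes "f differentiable (at x)"
  shows "(f has_derivative (\<lambda>h. grad f x \<bullet> h)) (at x)"
proof -
  have d: "(f has_derivative frechet_derivative f (at x)) (at x)"
    using assms by (simp add: frechet_derivative_works)
  then have l: "linear (frechet_derivative f (at x))"
    by (rule has_derivative_linear)
  have "frechet_derivative f (at x) h = grad f x \<bullet> h" for h
  proof -
    have "frechet_derivative f (at x) h = frechet_derivative f (at x) (\<Sum>i\<in>Basis. (h \<bullet> i) *\<^sub>R i)"
      by (simp add: euclidean_representation)
    also have "\<dots> = (\<Sum>i\<in>Basis. (h \<bullet> i) * frechet_derivative f (at x) i)"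
      using l by (simp add: linear_sum linear_cmul)
    also have "\<dots> = grad f x \<bullet> h"
      by (auto simp: grad_def inner_sum_left inner_commute[of h] intro!: sum.cong)
    finally show ?thesis .
  qed
  then show ?thesis
    using d by (metis (no_types, lifting) ext)
qed

lemma grad_eqI:
  fixes f :: "'a::euclidean_space \<Rightarrow> real"
  assumes "(f has_derivative (\<lambda>h. D \<bullet> h)) (at x)"
  shows "grad f x = D"
proof -
  have "frechet_derivative f (at x) = (\<lambda>h. D \<bullet> h)"
    using assms by (rule frechet_derivative_at[symmetric])
  then show ?thesis
    by (simp add: grad_def euclidean_representation)
qed

lemma grad_add_cmult:
  assumes "f differentiable (at x)" "g differentiable (at x)"
  shows "grad (\<lambda>x. f x + c * g x) x = grad f x + c *\<^sub>R grad g x"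
proof (rule grad_eqI)
  show "((\<lambda>x. f x + c * g x) has_derivative (\<lambda>h. (grad f x + c *\<^sub>R grad g x) \<bullet> h)) (at x)"
    by (auto intro!: derivative_eq_intros grad_has_derivative assms simp: inner_simps)
qed

lemma grad_comp:
  assumes "f differentiable (at x)" "(\<psi> has_real_derivative d) (at (f x))"
  shows "grad (\<lambda>x. \<psi> (f x)) x = d *\<^sub>R grad f x"
proof (rule grad_eqI)
  have "((\<lambda>x. \<psi> (f x)) has_derivative (\<lambda>h. d * (grad f x \<bullet> h))) (at x)"
    by (rule has_derivative_compose[OF grad_has_derivative[OF assms(1)]
          assms(2)[unfolded has_field_derivative_def]])
  then show "((\<lambda>x. \<psi> (f x)) has_derivative (\<lambda>h. (d *\<^sub>R grad f x) \<bullet> h)) (at x)"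
    by simp
qed

text \<open>The complement of the support is open and \<phi> is 0 throughout it, so the derivative
  at x is that of the zero function.\<close>

lemma test_fun_grad_outside:
  assumes "x \<notin> closure {x. \<phi> x \<noteq> 0}"
  shows "grad \<phi> x = 0"
proof (rule grad_eqI)
  have "((\<lambda>x. 0) has_derivative (\<lambda>h. 0)) (at x)"
    by simp
  then have "(\<phi> has_derivative (\<lambda>h. 0)) (at x)"
    by (rule has_derivative_transform_within_open[where s="- closure {x. \<phi> x \<noteq> 0}"])
      (use assms closure_subset[of "{x. \<phi> x \<noteq> 0}"] in auto)
  then show "(\<phi> has_derivative (\<lambda>h. 0 \<bullet> h)) (at x)"
    by simp
qed

lemma test_fun_outside: "test_fun \<Omega> \<phi> \<Longrightarrow> x \<notin> \<Omega> \<Longrightarrow> \<phi> x = 0"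
  and test_fun_grad_outside_domain: "test_fun \<Omega> \<phi> \<Longrightarrow> x \<notin> \<Omega> \<Longrightarrow> grad \<phi> x = 0"
  using closure_subset[of "{x. \<phi> x \<noteq> 0}"]
  by (auto simp: test_fun_def intro!: test_fun_grad_outside)

lemma borel_measurable_lebesgue_continuous:
  fixes f :: "'a::euclidean_space \<Rightarrow> 'b::euclidean_space"
  assumes "continuous_on UNIV f"
  shows "f \<in> borel_measurable lebesgue"
  using borel_measurable_continuous_onI[OF assms] by (intro measurable_completion) simp

lemma integrable_lebesgue_compact_support:
  fixes f :: "'a::euclidean_space \<Rightarrow> 'b::euclidean_space"
  assumes "continuous_on UNIV f" "compact K" "\<And>x. x \<notin> K \<Longrightarrow> f x = 0"
  shows "integrable lebesgue f"
proof -
  have "integrable lborel (\<lambda>x. indicator K x *\<^sub>R f x)"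
    using assms(2) continuous_on_subset[OF assms(1)] by (intro borel_integrable_compact) auto
  moreover have "(\<lambda>x. indicator K x *\<^sub>R f x) = f"
    using assms(3) by (auto simp: indicator_def)
  ultimately have "integrable lborel f"
    by simp
  then show ?thesis
    using assms(1) borel_measurable_continuous_onI by (subst integrable_completion) auto
qed

lemma square_integrable_compact_support:
  fixes f :: "'a::euclidean_space \<Rightarrow> 'b::euclidean_space"
  assumes "continuous_on UNIV f" "compact K" "\<And>x. x \<notin> K \<Longrightarrow> f x = 0"
  shows "square_integrable lebesgue f"
proof -
  have "integrable lebesgue (\<lambda>x. (norm (f x))\<^sup>2)"
    using assms by (intro integrable_lebesgue_compact_support[of _ K] continuous_intros) auto
  with assms(1) show ?thesis
    by (simp add: square_integrable_def borel_measurable_lebesgue_continuous)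
qed

lemma test_fun_square_integrable:
  assumes "test_fun \<Omega> \<phi>"
  shows "square_integrable lebesgue \<phi>" "square_integrable lebesgue (grad \<phi>)"
proof -
  let ?K = "closure {x. \<phi> x \<noteq> 0}"
  have K: "compact ?K" and s: "smooth_fun \<phi>"
    using assms by (auto simp: test_fun_def)
  have z: "\<phi> x = 0" if "x \<notin> ?K" for x
    using that closure_subset[of "{x. \<phi> x \<noteq> 0}"] by auto
  show "square_integrable lebesgue \<phi>"
    by (rule square_integrable_compact_support[OF smooth_fun_continuous[OF s] K z])
  show "square_integrable lebesgue (grad \<phi>)"
    by (rule square_integrable_compact_support[OF smooth_fun_continuous_grad[OF s] K
          test_fun_grad_outside])
qed

lemma test_fun_bounded:
  assumes "test_fun \<Omega> \<phi>"
  obtains B where "B > 0" "\<And>x. \<bar>\<phi> x\<bar> \<le> B"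
proof -
  let ?K = "closure {x. \<phi> x \<noteq> 0}"
  have "compact (\<phi> ` ?K)"
    using assms continuous_on_subset[OF smooth_fun_continuous[OF test_fun_smooth[OF assms]]]
    by (intro compact_continuous_image) (auto simp: test_fun_def)
  then obtain B where B: "B > 0" "\<forall>y\<in>\<phi> ` ?K. norm y \<le> B"
    using compact_imp_bounded[of "\<phi> ` ?K"] unfolding bounded_pos by auto
  have "\<bar>\<phi> x\<bar> \<le> B" for x
  proof (cases "\<phi> x = 0")
    case False
    then have "x \<in> ?K"
      using closure_subset[of "{x. \<phi> x \<noteq> 0}"] by auto
    then show ?thesis using B by auto
  qed (use B in auto)
  with B(1) show ?thesis by (rule that)
qed

section \<open>The space \<open>H\<^sub>0\<^sup>1\<close> and its chain rule\<close>

text \<open>Puts u in norm form as well, so that both halves become statements about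
  \<open>square_integrable\<close>.\<close>

lemma H01_iff_sequence:
  "H01 \<Omega> u G \<longleftrightarrow> square_integrable lebesgue u \<and> square_integrable lebesgue G \<and>
     (\<exists>\<phi>. (\<forall>k. test_fun \<Omega> (\<phi> k)) \<and>
        (\<lambda>k. LINT x|lebesgue. (norm (\<phi> k x - u x))\<^sup>2) \<longlonglongrightarrow> 0 \<and>
        (\<lambda>k. LINT x|lebesgue. (norm (grad (\<phi> k) x - G x))\<^sup>2) \<longlonglongrightarrow> 0)"
  unfolding H01_def square_integrable_def by (simp add: conj_ac)

lemma H01_square_integrable:
  assumes "H01 \<Omega> u G"
  shows "square_integrable lebesgue u" "square_integrable lebesgue G"
  using assms by (simp_all add: H01_iff_sequence)

lemma H01_approx:
  assumes "H01 \<Omega> u G" "e > 0"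
  obtains \<phi> where "test_fun \<Omega> \<phi>" "(LINT x|lebesgue. (norm (\<phi> x - u x))\<^sup>2) < e"
    "(LINT x|lebesgue. (norm (grad \<phi> x - G x))\<^sup>2) < e"
proof -
  obtain \<phi> where \<phi>: "\<And>k. test_fun \<Omega> (\<phi> k)"
    "(\<lambda>k. LINT x|lebesgue. (norm (\<phi> k x - u x))\<^sup>2) \<longlonglongrightarrow> 0"
    "(\<lambda>k. LINT x|lebesgue. (norm (grad (\<phi> k) x - G x))\<^sup>2) \<longlonglongrightarrow> 0"
    using assms(1) unfolding H01_iff_sequence by blast
  have "\<forall>\<^sub>F k in sequentially. (LINT x|lebesgue. (norm (\<phi> k x - u x))\<^sup>2) < e \<and>
      (LINT x|lebesgue. (norm (grad (\<phi> k) x - G x))\<^sup>2) < e"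
    by (intro eventually_conj order_tendstoD(2)[OF \<phi>(2)] order_tendstoD(2)[OF \<phi>(3)] assms(2))
  then obtain k where "(LINT x|lebesgue. (norm (\<phi> k x - u x))\<^sup>2) < e \<and>
      (LINT x|lebesgue. (norm (grad (\<phi> k) x - G x))\<^sup>2) < e"
    using eventually_happens'[OF sequentially_bot] by blast
  with \<phi>(1) that show ?thesis by blast
qed

lemma H01I_approx:
  assumes "square_integrable lebesgue u" "square_integrable lebesgue G"
    and approx: "\<And>e. e > 0 \<Longrightarrow> \<exists>\<phi>. test_fun \<Omega> \<phi> \<and> (LINT x|lebesgue. (norm (\<phi> x - u x))\<^sup>2) < e \<and>
      (LINT x|lebesgue. (norm (grad \<phi> x - G x))\<^sup>2) < e"
  shows "H01 \<Omega> u G"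
proof -
  have "\<forall>k. \<exists>\<phi>. test_fun \<Omega> \<phi> \<and> (LINT x|lebesgue. (norm (\<phi> x - u x))\<^sup>2) < 1 / real (Suc k) \<and>
      (LINT x|lebesgue. (norm (grad \<phi> x - G x))\<^sup>2) < 1 / real (Suc k)"
    by (intro allI approx) auto
  from choice[OF this] obtain \<phi> where \<phi>: "\<And>k. test_fun \<Omega> (\<phi> k)"
    "\<And>k. (LINT x|lebesgue. (norm (\<phi> k x - u x))\<^sup>2) < 1 / real (Suc k)"
    "\<And>k. (LINT x|lebesgue. (norm (grad (\<phi> k) x - G x))\<^sup>2) < 1 / real (Suc k)"
    by blast
  have "(\<lambda>k. LINT x|lebesgue. (norm (\<phi> k x - u x))\<^sup>2) \<longlonglongrightarrow> 0"
    by (rule tendsto_sandwich[OF _ _ tendsto_const lim_1_over_n[THEN LIMSEQ_Suc]])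
      (use \<phi>(2) in \<open>auto intro!: always_eventually less_imp_le\<close>)
  moreover have "(\<lambda>k. LINT x|lebesgue. (norm (grad (\<phi> k) x - G x))\<^sup>2) \<longlonglongrightarrow> 0"
    by (rule tendsto_sandwich[OF _ _ tendsto_const lim_1_over_n[THEN LIMSEQ_Suc]])
      (use \<phi>(3) in \<open>auto intro!: always_eventually less_imp_le\<close>)
  ultimately show ?thesis
    unfolding H01_iff_sequence using assms(1,2) \<phi>(1) by blast
qed

lemma test_fun_H01: "test_fun \<Omega> \<phi> \<Longrightarrow> H01 \<Omega> \<phi> (grad \<phi>)"
  by (rule H01I_approx) (auto simp: test_fun_square_integrable intro!: exI[of _ \<phi>])

text \<open>An epsilon argument takes the place of extracting a diagonal sequence of test
  functions.\<close>

lemma H01_closed: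
  assumes H: "\<And>k. H01 \<Omega> (u k) (G k)"
    and v: "square_integrable lebesgue v" and F: "square_integrable lebesgue F"
    and limu: "(\<lambda>k. LINT x|lebesgue. (norm (u k x - v x))\<^sup>2) \<longlonglongrightarrow> 0"
    and limG: "(\<lambda>k. LINT x|lebesgue. (norm (G k x - F x))\<^sup>2) \<longlonglongrightarrow> 0"
  shows "H01 \<Omega> v F"
proof (rule H01I_approx[OF v F])
  fix e :: real assume e: "e > 0"
  \<comment> \<open>A quarter of e suffices: |a + b|^2 \<le> 2|a|^2 + 2|b|^2 turns two such errors
    into less than e.\<close>
  have "\<forall>\<^sub>F k in sequentially. (LINT x|lebesgue. (norm (u k x - v x))\<^sup>2) < e / 4 \<and>
      (LINT x|lebesgue. (norm (G k x - F x))\<^sup>2) < e / 4"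
    using e by (intro eventually_conj order_tendstoD(2)[OF limu] order_tendstoD(2)[OF limG]) auto
  then obtain k where k: "(LINT x|lebesgue. (norm (u k x - v x))\<^sup>2) < e / 4"
      "(LINT x|lebesgue. (norm (G k x - F x))\<^sup>2) < e / 4"
    using eventually_happens'[OF sequentially_bot] by blast
  obtain \<phi> where \<phi>: "test_fun \<Omega> \<phi>" "(LINT x|lebesgue. (norm (\<phi> x - u k x))\<^sup>2) < e / 4"
    "(LINT x|lebesgue. (norm (grad \<phi> x - G k x))\<^sup>2) < e / 4"
    using H01_approx[OF H, of "e/4" k] e by auto
  note sq = H01_square_integrable[OF H, of k] test_fun_square_integrable[OF \<phi>(1)]
  have "(LINT x|lebesgue. (norm (\<phi> x - v x))\<^sup>2) < e"
    using integral_norm_add_square_le[OF square_integrable_diff[OF sq(3,1)]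
        square_integrable_diff[OF sq(1) v]] \<phi>(2) k(1) by simp
  moreover have "(LINT x|lebesgue. (norm (grad \<phi> x - F x))\<^sup>2) < e"
    using integral_norm_add_square_le[OF square_integrable_diff[OF sq(4,2)]
        square_integrable_diff[OF sq(2) F]] \<phi>(3) k(2) by simp
  ultimately show "\<exists>\<phi>. test_fun \<Omega> \<phi> \<and> (LINT x|lebesgue. (norm (\<phi> x - v x))\<^sup>2) < e \<and>
      (LINT x|lebesgue. (norm (grad \<phi> x - F x))\<^sup>2) < e"
    using \<phi>(1) by blast
qed

section \<open>Composition with C^1 functions of bounded derivative\<close>

lemma smooth_fun_power: "smooth_fun f \<Longrightarrow> smooth_fun (\<lambda>x. f x ^ n)"
  by (induction n) (simp_all add: smooth_fun_const smooth_fun_mult)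

lemma smooth_fun_sum: "(\<And>i. i \<in> I \<Longrightarrow> smooth_fun (f i)) \<Longrightarrow> smooth_fun (\<lambda>x. \<Sum>i\<in>I. f i x)"
  by (induction I rule: infinite_finite_induct) (simp_all add: smooth_fun_const smooth_fun_add)

lemma abs_le_of_derivative_bound:
  fixes f :: "real \<Rightarrow> real"
  assumes "\<And>s. \<bar>s\<bar> \<le> \<bar>t\<bar> \<Longrightarrow> (f has_real_derivative f' s) (at s)"
    and "\<And>s. \<bar>s\<bar> \<le> \<bar>t\<bar> \<Longrightarrow> \<bar>f' s\<bar> \<le> L" and "f 0 = 0"
  shows "\<bar>f t\<bar> \<le> L * \<bar>t\<bar>"
proof -
  have "norm (f t - f 0) \<le> L * norm (t - 0)"
    by (rule field_differentiable_bound[of "{-\<bar>t\<bar>..\<bar>t\<bar>}" f f'])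
      (use assms in \<open>auto simp: abs_le_iff has_field_derivative_at_within\<close>)
  with assms(3) show ?thesis by simp
qed

lemma square_integrable_comp:
  fixes \<psi> :: "real \<Rightarrow> real"
  assumes u: "square_integrable M u" and \<psi>: "continuous_on UNIV \<psi>" "\<And>t. \<bar>\<psi> t\<bar> \<le> L * \<bar>t\<bar>"
  shows "square_integrable M (\<lambda>x. \<psi> (u x))"
proof (rule square_integrable_bound)
  show "integrable M (\<lambda>x. L\<^sup>2 * (norm (u x))\<^sup>2)"
    using u by (simp add: square_integrable_def)
  show "(\<lambda>x. \<psi> (u x)) \<in> borel_measurable M"
    by (rule measurable_compose[OF square_integrable_measurable[OF u]
          borel_measurable_continuous_onI[OF \<psi>(1)]])
  show "AE x in M. (norm (\<psi> (u x)))\<^sup>2 \<le> L\<^sup>2 * (norm (u x))\<^sup>2"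
    using power_mono[OF \<psi>(2) abs_ge_zero, where n=2] by (auto simp: power_mult_distrib)
qed

lemma square_integrable_scaleR_bounded:
  fixes h :: "real \<Rightarrow> real"
  assumes u: "square_integrable M u" and G: "square_integrable M G"
    and h: "continuous_on UNIV h" "\<And>t. \<bar>h t\<bar> \<le> L"
  shows "square_integrable M (\<lambda>x. h (u x) *\<^sub>R G x)"
proof (rule square_integrable_bound)
  show "integrable M (\<lambda>x. L\<^sup>2 * (norm (G x))\<^sup>2)"
    using G by (simp add: square_integrable_def)
  have "(\<lambda>x. h (u x)) \<in> borel_measurable M"
    by (rule measurable_compose[OF square_integrable_measurable[OF u]
          borel_measurable_continuous_onI[OF h(1)]])
  then show "(\<lambda>x. h (u x) *\<^sub>R G x) \<in> borel_measurable M"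
    using square_integrable_measurable[OF G] by (intro borel_measurable_scaleR)
  show "AE x in M. (norm (h (u x) *\<^sub>R G x))\<^sup>2 \<le> L\<^sup>2 * (norm (G x))\<^sup>2"
    using power_mono[OF h(2) abs_ge_zero, where n=2]
    by (auto simp: power_mult_distrib intro!: mult_right_mono)
qed

text \<open>Polynomials without constant term map test functions to test functions; a general \<open>C\<^sup>1\<close>
  function is reached by approximating its derivative uniformly by polynomials.\<close>

lemma test_fun_comp_H01:
  fixes \<psi> h :: "real \<Rightarrow> real"
  assumes \<phi>: "test_fun \<Omega> \<phi>"
    and \<psi>: "\<And>t. (\<psi> has_real_derivative h t) (at t)" "\<psi> 0 = 0"
    and h: "continuous_on UNIV h" "\<And>t. \<bar>h t\<bar> \<le> L"
  shows "H01 \<Omega> (\<lambda>x. \<psi> (\<phi> x)) (\<lambda>x. h (\<phi> x) *\<^sub>R grad \<phi> x)"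
proof (rule H01I_approx)
  note sq = test_fun_square_integrable[OF \<phi>]
  have cont: "continuous_on UNIV \<psi>"
    using \<psi>(1) by (intro DERIV_continuous_on) auto
  have lip: "\<bar>\<psi> t\<bar> \<le> L * \<bar>t\<bar>" for t
    by (rule abs_le_of_derivative_bound[OF \<psi>(1) h(2) \<psi>(2)])
  show sq\<psi>: "square_integrable lebesgue (\<lambda>x. \<psi> (\<phi> x))"
    by (rule square_integrable_comp[OF sq(1) cont lip])
  show sqG: "square_integrable lebesgue (\<lambda>x. h (\<phi> x) *\<^sub>R grad \<phi> x)"
    by (rule square_integrable_scaleR_bounded[OF sq h])
  fix e :: real assume e: "e > 0"
  define A where "A = (LINT x|lebesgue. (norm (\<phi> x))\<^sup>2)"
  define A' where "A' = (LINT x|lebesgue. (norm (grad \<phi> x))\<^sup>2)"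
  have A: "0 \<le> A" "0 \<le> A'"
    by (simp_all add: A_def A'_def)
  \<comment> \<open>The tolerance for the derivative: it makes d^2 A and d^2 A' smaller than e, and
    the \<open>+ 1\<close> covers \<phi> = 0.\<close>
  define d where "d = sqrt (e / (A + A' + 1))"
  have d: "d > 0" "d\<^sup>2 = e / (A + A' + 1)"
    using e A by (simp_all add: d_def)
  have small: "d\<^sup>2 * A < e" "d\<^sup>2 * A' < e"
    using e A by (auto simp: d(2) field_simps intro!: add_pos_nonneg)
  obtain B where B: "B > 0" "\<And>x. \<bar>\<phi> x\<bar> \<le> B"
    using test_fun_bounded[OF \<phi>] by blast
  \<comment> \<open>Approximation takes place on a compact interval containing the range of \<phi>,
    where Weierstrass applies.\<close>
  obtain q where q: "real_polynomial_function q" "\<And>t. t \<in> {-B..B} \<Longrightarrow> \<bar>h t - q t\<bar> < d"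
    using Stone_Weierstrass_real_polynomial_function[of "{-B..B}" h d] d(1)
      continuous_on_subset[OF h(1)] by auto
  obtain a n where qsum: "q = (\<lambda>t. \<Sum>i\<le>n. a i * t ^ i)"
    using q(1) unfolding real_polynomial_function_iff_sum by blast
  \<comment> \<open>The termwise primitive of q without constant term: \<open>Q 0 = 0\<close> keeps
    the support inside that of \<phi>, and the closeness of q to h integrates to
    \<open>close\<close>.\<close>
  define Q where "Q t = (\<Sum>i\<le>n. a i / real (Suc i) * t ^ Suc i)" for t
  have Q: "(Q has_real_derivative q t) (at t)" for t
  proof -
    have "((\<lambda>t. a i / real (Suc i) * t ^ Suc i) has_real_derivative a i * t ^ i) (at t)" for i
    proof -
      have "((\<lambda>t. a i / real (Suc i) * t ^ Suc i) has_real_derivative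
          a i / real (Suc i) * (real (Suc i) * t ^ i)) (at t)"
        using DERIV_cmult[OF DERIV_pow[of "Suc i" t], of "a i / real (Suc i)"]
        by (simp only: diff_Suc_Suc diff_zero)
      then show ?thesis by (simp del: of_nat_Suc)
    qed
    then show ?thesis
      unfolding Q_def[abs_def] qsum by (intro DERIV_sum)
  qed
  have close: "\<bar>Q t - \<psi> t\<bar> \<le> d * \<bar>t\<bar>" if "\<bar>t\<bar> \<le> B" for t
  proof (rule abs_le_of_derivative_bound)
    show "((\<lambda>t. Q t - \<psi> t) has_real_derivative q s - h s) (at s)" for s
      by (intro DERIV_diff Q \<psi>)
    show "\<bar>q s - h s\<bar> \<le> d" if "\<bar>s\<bar> \<le> \<bar>t\<bar>" for s
    proof -
      have "s \<in> {-B..B}"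
        using that \<open>\<bar>t\<bar> \<le> B\<close> unfolding atLeastAtMost_iff by linarith
      from q(2)[OF this] show ?thesis by linarith
    qed
    show "Q 0 - \<psi> 0 = 0"
      by (simp add: Q_def \<psi>(2))
  qed
  have test: "test_fun \<Omega> (\<lambda>x. Q (\<phi> x))"
  proof (rule test_fun_of_vanishing[OF \<phi>])
    show "smooth_fun (\<lambda>x. Q (\<phi> x))"
      unfolding Q_def
      by (intro smooth_fun_sum smooth_fun_mult smooth_fun_const smooth_fun_power test_fun_smooth[OF \<phi>])
    show "Q (\<phi> x) = 0" if "\<phi> x = 0" for x
      using that by (simp add: Q_def)
  qed
  have gradQ: "grad (\<lambda>x. Q (\<phi> x)) x = q (\<phi> x) *\<^sub>R grad \<phi> x" for x
    by (rule grad_comp[OF smooth_fun_differentiable[OF test_fun_smooth[OF \<phi>]] Q])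
  note sqQ = test_fun_square_integrable[OF test]
  have "(LINT x|lebesgue. (norm (Q (\<phi> x) - \<psi> (\<phi> x)))\<^sup>2) \<le> (LINT x|lebesgue. d\<^sup>2 * (norm (\<phi> x))\<^sup>2)"
  proof (rule integral_mono)
    show "integrable lebesgue (\<lambda>x. (norm (Q (\<phi> x) - \<psi> (\<phi> x)))\<^sup>2)"
      by (rule square_integrable_integrable[OF square_integrable_diff[OF sqQ(1) sq\<psi>]])
    show "integrable lebesgue (\<lambda>x. d\<^sup>2 * (norm (\<phi> x))\<^sup>2)"
      using square_integrable_integrable[OF sq(1)] by simp
    show "(norm (Q (\<phi> x) - \<psi> (\<phi> x)))\<^sup>2 \<le> d\<^sup>2 * (norm (\<phi> x))\<^sup>2" for x
      using power_mono[OF close[OF B(2)[of x]] abs_ge_zero, of 2] by (simp add: power_mult_distrib)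
  qed
  also have "\<dots> = d\<^sup>2 * A"
    by (simp add: A_def)
  finally have 1: "(LINT x|lebesgue. (norm (Q (\<phi> x) - \<psi> (\<phi> x)))\<^sup>2) < e"
    using small(1) by simp
  have "(LINT x|lebesgue. (norm (grad (\<lambda>x. Q (\<phi> x)) x - h (\<phi> x) *\<^sub>R grad \<phi> x))\<^sup>2)
      \<le> (LINT x|lebesgue. d\<^sup>2 * (norm (grad \<phi> x))\<^sup>2)"
  proof (rule integral_mono)
    show "integrable lebesgue (\<lambda>x. (norm (grad (\<lambda>x. Q (\<phi> x)) x - h (\<phi> x) *\<^sub>R grad \<phi> x))\<^sup>2)"
      by (rule square_integrable_integrable[OF square_integrable_diff[OF sqQ(2) sqG]])
    show "integrable lebesgue (\<lambda>x. d\<^sup>2 * (norm (grad \<phi> x))\<^sup>2)"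
      using square_integrable_integrable[OF sq(2)] by simp
    fix x
    have "\<bar>q (\<phi> x) - h (\<phi> x)\<bar> \<le> d"
    proof -
      have "\<phi> x \<in> {-B..B}"
        using B(2)[of x] unfolding atLeastAtMost_iff by linarith
      from q(2)[OF this] show ?thesis by linarith
    qed
    then have "(q (\<phi> x) - h (\<phi> x))\<^sup>2 \<le> d\<^sup>2"
      using power_mono[OF _ abs_ge_zero, of _ d 2] by simp
    then show "(norm (grad (\<lambda>x. Q (\<phi> x)) x - h (\<phi> x) *\<^sub>R grad \<phi> x))\<^sup>2 \<le> d\<^sup>2 * (norm (grad \<phi> x))\<^sup>2"
      unfolding gradQ scaleR_diff_left[symmetric]
      by (simp add: power_mult_distrib mult_right_mono)
  qed
  also have "\<dots> = d\<^sup>2 * A'"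
    by (simp add: A'_def)
  finally have 2: "(LINT x|lebesgue. (norm (grad (\<lambda>x. Q (\<phi> x)) x - h (\<phi> x) *\<^sub>R grad \<phi> x))\<^sup>2) < e"
    using small(2) by simp
  show "\<exists>\<phi>'. test_fun \<Omega> \<phi>' \<and> (LINT x|lebesgue. (norm (\<phi>' x - \<psi> (\<phi> x)))\<^sup>2) < e \<and>
      (LINT x|lebesgue. (norm (grad \<phi>' x - h (\<phi> x) *\<^sub>R grad \<phi> x))\<^sup>2) < e"
    using test 1 2 by blast
qed

text \<open>With test functions \<phi>_k tending to u, the function part follows from the Lipschitz
  bound L. The gradient error splits as h(\<phi>_k)(D\<phi>_k - G) + (h(\<phi>_k) - h(u))G: the
  first term is bounded by L, the second tends to 0 by dominated convergence. Only the second needs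
  pointwise convergence of \<phi>_k, which is why a subsequence is taken.\<close>

lemma H01_chain_rule:
  fixes u :: "'a::euclidean_space \<Rightarrow> real" and \<psi> h :: "real \<Rightarrow> real"
  assumes u: "H01 \<Omega> u G"
    and \<psi>: "\<And>t. (\<psi> has_real_derivative h t) (at t)" "\<psi> 0 = 0"
    and h: "continuous_on UNIV h" "\<And>t. \<bar>h t\<bar> \<le> L"
  shows "H01 \<Omega> (\<lambda>x. \<psi> (u x)) (\<lambda>x. h (u x) *\<^sub>R G x)"
proof -
  note squ = H01_square_integrable[OF u]
  have cont: "continuous_on UNIV \<psi>"
    using \<psi>(1) by (intro DERIV_continuous_on) auto
  have lip0: "\<bar>\<psi> t\<bar> \<le> L * \<bar>t\<bar>" for t
    by (rule abs_le_of_derivative_bound[OF \<psi>(1) h(2) \<psi>(2)])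
  have lip: "\<bar>\<psi> s - \<psi> t\<bar> \<le> L * \<bar>s - t\<bar>" for s t
    using field_differentiable_bound[of UNIV \<psi> h L s t] \<psi>(1) h(2) by auto
  obtain \<phi>0 where \<phi>0: "\<And>k. test_fun \<Omega> (\<phi>0 k)"
    "(\<lambda>k. LINT x|lebesgue. (norm (\<phi>0 k x - u x))\<^sup>2) \<longlonglongrightarrow> 0"
    "(\<lambda>k. LINT x|lebesgue. (norm (grad (\<phi>0 k) x - G x))\<^sup>2) \<longlonglongrightarrow> 0"
    using u unfolding H01_iff_sequence by blast
  obtain r :: "nat \<Rightarrow> nat" where r: "strict_mono r"
    and ae0: "AE x in lebesgue. (\<lambda>k. \<phi>0 (r k) x) \<longlonglongrightarrow> u x"
    using AE_subseq_of_L2_tendsto[OF test_fun_square_integrable(1)[OF \<phi>0(1)] squ(1) \<phi>0(2)] by blast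
  define \<phi> where "\<phi> k = \<phi>0 (r k)" for k
  have \<phi>: "\<And>k. test_fun \<Omega> (\<phi> k)"
    "(\<lambda>k. LINT x|lebesgue. (norm (\<phi> k x - u x))\<^sup>2) \<longlonglongrightarrow> 0"
    "(\<lambda>k. LINT x|lebesgue. (norm (grad (\<phi> k) x - G x))\<^sup>2) \<longlonglongrightarrow> 0"
    using \<phi>0(1) LIMSEQ_subseq_LIMSEQ[OF \<phi>0(2) r] LIMSEQ_subseq_LIMSEQ[OF \<phi>0(3) r]
    by (simp_all add: \<phi>_def comp_def)
  have ae: "AE x in lebesgue. (\<lambda>k. \<phi> k x) \<longlonglongrightarrow> u x"
    using ae0 by (simp add: \<phi>_def)
  note sq\<phi> = test_fun_square_integrable[OF \<phi>(1)]
  have sq\<psi>: "square_integrable lebesgue (\<lambda>x. \<psi> (u x))"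
    by (rule square_integrable_comp[OF squ(1) cont lip0])
  have sqG: "square_integrable lebesgue (\<lambda>x. h (u x) *\<^sub>R G x)"
    by (rule square_integrable_scaleR_bounded[OF squ h])
  have sq1: "square_integrable lebesgue (\<lambda>x. \<psi> (\<phi> k x))" for k
    by (rule square_integrable_comp[OF sq\<phi>(1) cont lip0])
  have sq2: "square_integrable lebesgue (\<lambda>x. h (\<phi> k x) *\<^sub>R (grad (\<phi> k) x - G x))" for k
    by (rule square_integrable_scaleR_bounded[OF sq\<phi>(1) square_integrable_diff[OF sq\<phi>(2) squ(2)] h])
  have sq3: "square_integrable lebesgue (\<lambda>x. (h (\<phi> k x) - h (u x)) *\<^sub>R G x)" for k
    using square_integrable_diff[OF square_integrable_scaleR_bounded[OF sq\<phi>(1) squ(2) h] sqG]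
    by (simp add: scaleR_diff_left)
  show ?thesis
  proof (rule H01_closed)
    show "H01 \<Omega> (\<lambda>x. \<psi> (\<phi> k x)) (\<lambda>x. h (\<phi> k x) *\<^sub>R grad (\<phi> k) x)" for k
      by (rule test_fun_comp_H01[OF \<phi>(1) \<psi> h])
    have le1: "(LINT x|lebesgue. (norm (\<psi> (\<phi> k x) - \<psi> (u x)))\<^sup>2)
        \<le> L\<^sup>2 * (LINT x|lebesgue. (norm (\<phi> k x - u x))\<^sup>2)" for k
    proof -
      have "(LINT x|lebesgue. (norm (\<psi> (\<phi> k x) - \<psi> (u x)))\<^sup>2)
          \<le> (LINT x|lebesgue. L\<^sup>2 * (norm (\<phi> k x - u x))\<^sup>2)"
      proof (rule integral_mono)
        show "integrable lebesgue (\<lambda>x. (norm (\<psi> (\<phi> k x) - \<psi> (u x)))\<^sup>2)"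
          by (rule square_integrable_integrable[OF square_integrable_diff[OF sq1 sq\<psi>]])
        show "integrable lebesgue (\<lambda>x. L\<^sup>2 * (norm (\<phi> k x - u x))\<^sup>2)"
          using square_integrable_integrable[OF square_integrable_diff[OF sq\<phi>(1) squ(1)]] by simp
        show "(norm (\<psi> (\<phi> k x) - \<psi> (u x)))\<^sup>2 \<le> L\<^sup>2 * (norm (\<phi> k x - u x))\<^sup>2" for x
          using power_mono[OF lip abs_ge_zero, of "\<phi> k x" "u x" 2] by (simp add: power_mult_distrib)
      qed
      then show ?thesis by simp
    qed
    show "(\<lambda>k. LINT x|lebesgue. (norm (\<psi> (\<phi> k x) - \<psi> (u x)))\<^sup>2) \<longlonglongrightarrow> 0"
      by (rule tendsto_sandwich[OF _ _ tendsto_const tendsto_mult_right_zero[OF \<phi>(2)]])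
        (use le1 in \<open>auto intro!: always_eventually\<close>)
    have le2: "(LINT x|lebesgue. (norm (h (\<phi> k x) *\<^sub>R grad (\<phi> k) x - h (u x) *\<^sub>R G x))\<^sup>2)
        \<le> 2 * (L\<^sup>2 * (LINT x|lebesgue. (norm (grad (\<phi> k) x - G x))\<^sup>2))
          + 2 * (LINT x|lebesgue. (norm ((h (\<phi> k x) - h (u x)) *\<^sub>R G x))\<^sup>2)" for k
    proof -
      have "(LINT x|lebesgue. (norm (h (\<phi> k x) *\<^sub>R grad (\<phi> k) x - h (u x) *\<^sub>R G x))\<^sup>2)
        \<le> 2 * (LINT x|lebesgue. (norm (h (\<phi> k x) *\<^sub>R (grad (\<phi> k) x - G x)))\<^sup>2)
          + 2 * (LINT x|lebesgue. (norm ((h (\<phi> k x) - h (u x)) *\<^sub>R G x))\<^sup>2)"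
        using integral_norm_add_square_le[OF sq2 sq3, of k k] by (simp add: algebra_simps)
      moreover have "(LINT x|lebesgue. (norm (h (\<phi> k x) *\<^sub>R (grad (\<phi> k) x - G x)))\<^sup>2)
          \<le> (LINT x|lebesgue. L\<^sup>2 * (norm (grad (\<phi> k) x - G x))\<^sup>2)"
      proof (rule integral_mono)
        show "integrable lebesgue (\<lambda>x. (norm (h (\<phi> k x) *\<^sub>R (grad (\<phi> k) x - G x)))\<^sup>2)"
          by (rule square_integrable_integrable[OF sq2])
        show "integrable lebesgue (\<lambda>x. L\<^sup>2 * (norm (grad (\<phi> k) x - G x))\<^sup>2)"
          using square_integrable_integrable[OF square_integrable_diff[OF sq\<phi>(2) squ(2)]] by simp
        show "(norm (h (\<phi> k x) *\<^sub>R (grad (\<phi> k) x - G x)))\<^sup>2 \<le> L\<^sup>2 * (norm (grad (\<phi> k) x - G x))\<^sup>2" for x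
          using power_mono[OF h(2) abs_ge_zero, of "\<phi> k x" 2]
          by (auto simp: power_mult_distrib intro!: mult_right_mono)
      qed
      ultimately show ?thesis by simp
    qed
    have "(\<lambda>k. LINT x|lebesgue. (norm ((h (\<phi> k x) - h (u x)) *\<^sub>R G x))\<^sup>2)
        \<longlonglongrightarrow> integral\<^sup>L lebesgue (\<lambda>x::'a. 0)"
    proof (rule integral_dominated_convergence[where w="\<lambda>x. (2 * L)\<^sup>2 * (norm (G x))\<^sup>2"])
      show "integrable lebesgue (\<lambda>x. (2 * L)\<^sup>2 * (norm (G x))\<^sup>2)"
        using square_integrable_integrable[OF squ(2)] by simp
      show "(\<lambda>x. (norm ((h (\<phi> k x) - h (u x)) *\<^sub>R G x))\<^sup>2) \<in> borel_measurable lebesgue" for k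
        using square_integrable_integrable[OF sq3] by (rule borel_measurable_integrable)
      show "AE x in lebesgue. (\<lambda>k. (norm ((h (\<phi> k x) - h (u x)) *\<^sub>R G x))\<^sup>2) \<longlonglongrightarrow> 0"
        using ae
      proof eventually_elim
        case (elim x)
        have "isCont h (u x)"
          using h(1) by (simp add: continuous_on_eq_continuous_at)
        then have "(\<lambda>k. h (\<phi> k x)) \<longlonglongrightarrow> h (u x)"
          using elim by (rule isCont_tendsto_compose)
        then have "(\<lambda>k. (norm ((h (\<phi> k x) - h (u x)) *\<^sub>R G x))\<^sup>2)
            \<longlonglongrightarrow> (norm ((h (u x) - h (u x)) *\<^sub>R G x))\<^sup>2"
          by (intro tendsto_intros)
        then show ?case by simp
      qed
      show "AE x in lebesgue. norm ((norm ((h (\<phi> k x) - h (u x)) *\<^sub>R G x))\<^sup>2)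
          \<le> (2 * L)\<^sup>2 * (norm (G x))\<^sup>2" for k
      proof (rule AE_I2)
        fix x
        have "\<bar>h (\<phi> k x) - h (u x)\<bar> \<le> 2 * L"
          using h(2)[of "\<phi> k x"] h(2)[of "u x"] by linarith
        from power_mono[OF this abs_ge_zero, of 2]
        show "norm ((norm ((h (\<phi> k x) - h (u x)) *\<^sub>R G x))\<^sup>2) \<le> (2 * L)\<^sup>2 * (norm (G x))\<^sup>2"
          by (simp add: power_mult_distrib mult_right_mono)
      qed
    qed simp
    then have lim2: "(\<lambda>k. 2 * (L\<^sup>2 * (LINT x|lebesgue. (norm (grad (\<phi> k) x - G x))\<^sup>2))
        + 2 * (LINT x|lebesgue. (norm ((h (\<phi> k x) - h (u x)) *\<^sub>R G x))\<^sup>2)) \<longlonglongrightarrow> 2 * (L\<^sup>2 * 0) + 2 * 0"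
      by (intro tendsto_intros \<phi>(3)) simp
    show "(\<lambda>k. LINT x|lebesgue. (norm (h (\<phi> k x) *\<^sub>R grad (\<phi> k) x - h (u x) *\<^sub>R G x))\<^sup>2) \<longlonglongrightarrow> 0"
      by (rule tendsto_sandwich[OF _ _ tendsto_const lim2[simplified]])
        (use le2 in \<open>auto intro!: always_eventually\<close>)
  qed (rule sq\<psi> sqG)+
qed

section \<open>Existence of the torsion function\<close>

lemma set_lebesgue_integral_eq_inner:
  fixes u :: "'a \<Rightarrow> real"
  shows "(LINT x:S|M. u x) = (LINT x|M. u x \<bullet> indicator S x)"
  by (simp add: set_lebesgue_integral_def mult.commute)

text \<open>A subsequence of test functions converges to u almost everywhere. This identifies
  integrals over \<Omega> with integrals over the whole space and lets a constant be replaced by the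
  indicator of \<Omega>.\<close>

lemma H01_AE_zero_outside:
  assumes "H01 \<Omega> u G"
  shows "AE x in lebesgue. x \<notin> \<Omega> \<longrightarrow> u x = 0"
proof -
  obtain \<phi> where \<phi>: "\<And>k. test_fun \<Omega> (\<phi> k)"
    "(\<lambda>k. LINT x|lebesgue. (norm (\<phi> k x - u x))\<^sup>2) \<longlonglongrightarrow> 0"
    using assms unfolding H01_iff_sequence by blast
  obtain r :: "nat \<Rightarrow> nat" where "AE x in lebesgue. (\<lambda>k. \<phi> (r k) x) \<longlonglongrightarrow> u x"
    using AE_subseq_of_L2_tendsto[OF test_fun_square_integrable(1)[OF \<phi>(1)]
        H01_square_integrable(1)[OF assms] \<phi>(2)] by blast
  then show ?thesis
  proof eventually_elim
    case (elim x)
    show ?case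
    proof
      assume "x \<notin> \<Omega>"
      then have "\<phi> (r k) x = 0" for k
        by (rule test_fun_outside[OF \<phi>(1)])
      with elim show "u x = 0"
        by (simp add: LIMSEQ_const_iff)
    qed
  qed
qed

text \<open>Density: since \<Omega> has finite measure, its indicator is square integrable, so both
  sides are continuous under H^1 convergence.\<close>

lemma weak_form_H01:
  assumes \<Omega>: "\<Omega> \<in> sets lebesgue" "emeasure lebesgue \<Omega> < \<infinity>"
    and G: "square_integrable lebesgue G"
    and weak: "\<And>\<phi>. test_fun \<Omega> \<phi> \<Longrightarrow>
      (LINT x|lebesgue. G x \<bullet> grad \<phi> x) = (LINT x:\<Omega>|lebesgue. \<phi> x)"
    and u: "H01 \<Omega> u H"
  shows "(LINT x|lebesgue. G x \<bullet> H x) = (LINT x:\<Omega>|lebesgue. u x)"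
proof -
  obtain \<phi> where \<phi>: "\<And>k. test_fun \<Omega> (\<phi> k)"
    "(\<lambda>k. LINT x|lebesgue. (norm (\<phi> k x - u x))\<^sup>2) \<longlonglongrightarrow> 0"
    "(\<lambda>k. LINT x|lebesgue. (norm (grad (\<phi> k) x - H x))\<^sup>2) \<longlonglongrightarrow> 0"
    using u unfolding H01_iff_sequence by blast
  note sq = H01_square_integrable[OF u] test_fun_square_integrable[OF \<phi>(1)]
  have "(\<lambda>k. LINT x|lebesgue. grad (\<phi> k) x \<bullet> G x) \<longlonglongrightarrow> (LINT x|lebesgue. H x \<bullet> G x)"
    by (rule integral_inner_tendsto[OF sq(4,2) G \<phi>(3)])
  then have 1: "(\<lambda>k. LINT x:\<Omega>|lebesgue. \<phi> k x) \<longlonglongrightarrow> (LINT x|lebesgue. G x \<bullet> H x)"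
    by (simp add: weak[OF \<phi>(1), symmetric] inner_commute)
  have 2: "(\<lambda>k. LINT x:\<Omega>|lebesgue. \<phi> k x) \<longlonglongrightarrow> (LINT x:\<Omega>|lebesgue. u x)"
    unfolding set_lebesgue_integral_eq_inner
    by (rule integral_inner_tendsto[OF sq(3,1) square_integrable_indicator(1)[OF \<Omega>] \<phi>(2)])
  show ?thesis
    by (rule LIMSEQ_unique[OF 1 2])
qed

text \<open>The first-order condition at a minimum. The witness t = -a/(b + 1) gives the value
  -(a/(b + 1))^2, also when b = 0.\<close>

lemma linear_coefficient_zero:
  fixes a b :: real
  assumes "\<And>t. 0 \<le> t * a + t\<^sup>2 * b" "0 \<le> b"
  shows "a = 0"
proof -
  have "0 \<le> - a / (b + 1) * a + (- a / (b + 1))\<^sup>2 * b"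
    by (rule assms(1))
  also have "\<dots> = - (a / (b + 1))\<^sup>2"
    using assms(2) by (simp add: divide_simps power2_eq_square) (simp add: algebra_simps)
  finally show ?thesis
    using assms(2) by simp
qed

text \<open>Direct method: a sequence of test functions minimising \<open>\<integral>|D\<phi>|\<^sup>2/2 - \<integral>\<phi>\<close> is Cauchy in
  \<open>H\<^sup>1\<close> by the parallelogram identity, and its limit solves the Euler-Lagrange equation.\<close>

lemma torsion_exists:
  fixes \<Omega> :: "'a::euclidean_space set"
  assumes \<Omega>: "\<Omega> \<in> sets lebesgue" "emeasure lebesgue \<Omega> < \<infinity>"
    and c: "c > 0"
    and poincare: "\<And>u G. H01 \<Omega> u G \<Longrightarrow>
      c * (LINT x|lebesgue. (u x)\<^sup>2) \<le> (LINT x|lebesgue. (norm (G x))\<^sup>2)"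
  shows "\<exists>v. is_torsion \<Omega> v"
proof -
  define D where "D \<phi> = (LINT x|lebesgue. (norm (grad \<phi> x))\<^sup>2)" for \<phi> :: "'a \<Rightarrow> real"
  define I where "I \<phi> = (LINT x:\<Omega>|lebesgue. \<phi> x)" for \<phi> :: "'a \<Rightarrow> real"
  define J where "J \<phi> = D \<phi> / 2 - I \<phi>" for \<phi>
  define X where "X \<phi> \<psi> = (LINT x|lebesgue. grad \<phi> x \<bullet> grad \<psi> x)" for \<phi> \<psi> :: "'a \<Rightarrow> real"
  define T where "T = Collect (test_fun \<Omega>)"
  note ind = square_integrable_indicator[OF \<Omega>]
  have grad_add: "grad (\<lambda>x. \<phi> x + t * \<psi> x) = (\<lambda>x. grad \<phi> x + t *\<^sub>R grad \<psi> x)"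
    if "test_fun \<Omega> \<phi>" "test_fun \<Omega> \<psi>" for \<phi> \<psi> t
    using grad_add_cmult smooth_fun_differentiable test_fun_smooth that by blast
  have test_add: "test_fun \<Omega> (\<lambda>x. \<phi> x + t * \<psi> x)"
    if "test_fun \<Omega> \<phi>" "test_fun \<Omega> \<psi>" for \<phi> \<psi> t
    using that by (intro test_fun_add test_fun_cmult)
  have D_add: "D (\<lambda>x. \<phi> x + t * \<psi> x) = D \<phi> + 2 * t * X \<phi> \<psi> + t\<^sup>2 * D \<psi>"
    if "test_fun \<Omega> \<phi>" "test_fun \<Omega> \<psi>" for \<phi> \<psi> t
    unfolding D_def X_def grad_add[OF that]
    by (rule integral_norm_add_scaleR_square) (use that test_fun_square_integrable in auto)
  have I_add: "I (\<lambda>x. \<phi> x + t * \<psi> x) = I \<phi> + t * I \<psi>"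
    if "test_fun \<Omega> \<phi>" "test_fun \<Omega> \<psi>" for \<phi> \<psi> t
    unfolding I_def set_lebesgue_integral_eq_inner
    using square_integrable_inner[OF test_fun_square_integrable(1)[OF that(1)] ind(1)]
      square_integrable_inner[OF test_fun_square_integrable(1)[OF that(2)] ind(1)]
    by (simp add: algebra_simps)
  have J_add: "J (\<lambda>x. \<phi> x + t * \<psi> x) = J \<phi> + t * (X \<phi> \<psi> - I \<psi>) + t\<^sup>2 * (D \<psi> / 2)"
    if "test_fun \<Omega> \<phi>" "test_fun \<Omega> \<psi>" for \<phi> \<psi> t
    unfolding J_def D_add[OF that] I_add[OF that] by (simp add: algebra_simps)
  \<comment> \<open>Cauchy-Schwarz and Poincare give (I \<phi>)^2 \<le> K D \<phi>, and the
    arithmetic-geometric mean inequality then bounds J below by -K/2.\<close>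
  define K where "K = measure lebesgue \<Omega> / c"
  have K: "0 \<le> K"
    using c by (simp add: K_def)
  have pt: "c * (LINT x|lebesgue. (norm (\<phi> x))\<^sup>2) \<le> D \<phi>" if "test_fun \<Omega> \<phi>" for \<phi>
    using poincare[OF test_fun_H01[OF that]] by (simp add: D_def)
  have D0: "0 \<le> D \<phi>" for \<phi>
    by (simp add: D_def)
  have J_lower: "- K / 2 \<le> J \<phi>" if "test_fun \<Omega> \<phi>" for \<phi>
  proof -
    have "(I \<phi>)\<^sup>2 \<le> (LINT x|lebesgue. (norm (\<phi> x))\<^sup>2) * measure lebesgue \<Omega>"
      unfolding I_def set_lebesgue_integral_eq_inner ind(2)[symmetric]
      by (rule integral_Cauchy_Schwarz[OF test_fun_square_integrable(1)[OF that] ind(1)])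
    also have "\<dots> \<le> (D \<phi> / c) * measure lebesgue \<Omega>"
      using pt[OF that] c by (intro mult_right_mono) (simp_all add: field_simps)
    also have "\<dots> = D \<phi> * K"
      by (simp add: K_def)
    also have "\<dots> \<le> (D \<phi> / 2 + K / 2)\<^sup>2"
      using sum_squares_bound[of "D \<phi>" K] by (simp add: power2_eq_square algebra_simps)
    finally have "I \<phi> \<le> D \<phi> / 2 + K / 2"
      by (rule power2_le_imp_le) (use D0[of \<phi>] K in simp)
    then show ?thesis
      by (simp add: J_def)
  qed
  have bdd: "bdd_below (J ` T)"
    unfolding bdd_below_def using J_lower by (auto simp: T_def)
  have ne: "J ` T \<noteq> {}"
    using test_fun_zero by (auto simp: T_def)
  define m where "m = Inf (J ` T)"
  have m_le: "m \<le> J \<phi>" if "test_fun \<Omega> \<phi>" for \<phi>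
    unfolding m_def using bdd that by (intro cInf_lower) (auto simp: T_def)
  have "\<exists>\<phi>. test_fun \<Omega> \<phi> \<and> J \<phi> < m + 1 / real (Suc k)" for k
  proof -
    have "Inf (J ` T) < m + 1 / real (Suc k)"
      by (simp add: m_def)
    from cInf_lessD[OF ne this] show ?thesis
      by (auto simp: T_def)
  qed
  then have "\<forall>k. \<exists>\<phi>. test_fun \<Omega> \<phi> \<and> J \<phi> < m + 1 / real (Suc k)"
    by blast
  from choice[OF this] obtain \<phi>
    where \<phi>: "\<And>k. test_fun \<Omega> (\<phi> k)" "\<And>k. J (\<phi> k) < m + 1 / real (Suc k)"
    by blast
  have close: "(LINT x|lebesgue. (norm (grad (\<phi> i) x - grad (\<phi> j) x))\<^sup>2)
        \<le> 4 * (1 / real (Suc i) + 1 / real (Suc j))"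
    and close': "c * (LINT x|lebesgue. (norm (\<phi> i x - \<phi> j x))\<^sup>2)
        \<le> 4 * (1 / real (Suc i) + 1 / real (Suc j))" for i j
  proof -
    define w where "w = (\<lambda>x. \<phi> i x + (- 1) * \<phi> j x)"
    have w: "test_fun \<Omega> w"
      unfolding w_def by (intro test_add \<phi>)
    have gw: "grad w = (\<lambda>x. grad (\<phi> i) x - grad (\<phi> j) x)"
      unfolding w_def grad_add[OF \<phi>(1) \<phi>(1)] by simp
    have wi: "(\<lambda>x. \<phi> j x + 1 * w x) = \<phi> i"
      by (simp add: w_def)
    \<comment> \<open>This is the midpoint of \<phi> i and \<phi> j. As J is quadratic along the
      segment, comparing t = 1/2 with t = 0 and t = 1 eliminates the linear term and gives D w = 4
      (J(\<phi> i) + J(\<phi> j) - 2 J(midpoint)).\<close>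
    have "m \<le> J (\<lambda>x. \<phi> j x + (1/2) * w x)"
      by (intro m_le test_add \<phi> w)
    then have "D w \<le> 4 * (J (\<phi> i) - m + (J (\<phi> j) - m))"
      using J_add[OF \<phi>(1)[of j] w, of "1/2"] J_add[OF \<phi>(1)[of j] w, of 1]
      unfolding wi by (simp add: power2_eq_square diff_divide_distrib)
    also have "\<dots> \<le> 4 * (1 / real (Suc i) + 1 / real (Suc j))"
      using \<phi>(2)[of i] \<phi>(2)[of j] by simp
    finally have Dw: "D w \<le> 4 * (1 / real (Suc i) + 1 / real (Suc j))" .
    then show "(LINT x|lebesgue. (norm (grad (\<phi> i) x - grad (\<phi> j) x))\<^sup>2)
        \<le> 4 * (1 / real (Suc i) + 1 / real (Suc j))"
      by (simp add: D_def gw)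
    show "c * (LINT x|lebesgue. (norm (\<phi> i x - \<phi> j x))\<^sup>2)
        \<le> 4 * (1 / real (Suc i) + 1 / real (Suc j))"
      using pt[OF w] Dw by (simp add: w_def)
  qed
  have small: "\<exists>N. \<forall>i\<ge>N. \<forall>j\<ge>N. 4 * (1 / real (Suc i) + 1 / real (Suc j)) < e" if "e > 0" for e :: real
  proof -
    have "0 < e / 8"
      using that by simp
    then obtain N where N: "1 / real (Suc N) < e / 8"
      by (rule nat_approx_posE)
    have le: "1 / real (Suc i) \<le> 1 / real (Suc N)" if "i \<ge> N" for i
      using that by (simp add: frac_le)
    have "4 * (1 / real (Suc i) + 1 / real (Suc j)) < e" if "i \<ge> N" "j \<ge> N" for i j
    proof -
      have "a \<le> n \<Longrightarrow> b \<le> n \<Longrightarrow> n < e / 8 \<Longrightarrow> 4 * (a + b) < e" for a b n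
        by simp
      from this[OF le[OF that(1)] le[OF that(2)] N] show ?thesis .
    qed
    then show ?thesis by blast
  qed
  note sq = test_fun_square_integrable[OF \<phi>(1)]
  obtain G where G: "square_integrable lebesgue G"
    "(\<lambda>k. LINT x|lebesgue. (norm (grad (\<phi> k) x - G x))\<^sup>2) \<longlonglongrightarrow> 0"
  proof (rule L2_complete_finite_support[OF sq(2) \<Omega> test_fun_grad_outside_domain[OF \<phi>(1)]])
    fix e :: real assume "e > 0"
    then obtain N where N: "\<forall>i\<ge>N. \<forall>j\<ge>N. 4 * (1 / real (Suc i) + 1 / real (Suc j)) < e"
      using small by blast
    show "\<exists>N. \<forall>i\<ge>N. \<forall>j\<ge>N. (LINT x|lebesgue. (norm (grad (\<phi> i) x - grad (\<phi> j) x))\<^sup>2) < e"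
      using le_less_trans[OF close] N by blast
  qed
  obtain v where v: "square_integrable lebesgue v"
    "(\<lambda>k. LINT x|lebesgue. (norm (\<phi> k x - v x))\<^sup>2) \<longlonglongrightarrow> 0"
  proof (rule L2_complete_finite_support[OF sq(1) \<Omega> test_fun_outside[OF \<phi>(1)]])
    fix e :: real assume "e > 0"
    then obtain N where N: "\<forall>i\<ge>N. \<forall>j\<ge>N. 4 * (1 / real (Suc i) + 1 / real (Suc j)) < c * e"
      using small[of "c * e"] c by auto
    have "c * (LINT x|lebesgue. (norm (\<phi> i x - \<phi> j x))\<^sup>2) < c * e" if "i \<ge> N" "j \<ge> N" for i j
      using le_less_trans[OF close'] N that by blast
    then show "\<exists>N. \<forall>i\<ge>N. \<forall>j\<ge>N. (LINT x|lebesgue. (norm (\<phi> i x - \<phi> j x))\<^sup>2) < e"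
      using c by (metis mult_less_cancel_left_pos)
  qed
  have H: "H01 \<Omega> v G"
    unfolding H01_iff_sequence using v G \<phi>(1) by blast
  have "(LINT x|lebesgue. G x \<bullet> grad \<psi> x) = I \<psi>" if \<psi>: "test_fun \<Omega> \<psi>" for \<psi>
  proof -
    define Y where "Y = (LINT x|lebesgue. G x \<bullet> grad \<psi> x)"
    have limX: "(\<lambda>k. X (\<phi> k) \<psi>) \<longlonglongrightarrow> Y"
      unfolding X_def Y_def
      by (rule integral_inner_tendsto[OF sq(2) G(1) test_fun_square_integrable(2)[OF \<psi>] G(2)])
    \<comment> \<open>J(\<phi> k) exceeds the infimum by less than 1/(k + 1), so a variation along
      \<psi> cannot lower J by more; this slack vanishes in the limit.\<close>
    have "0 \<le> t * (Y - I \<psi>) + t\<^sup>2 * (D \<psi> / 2)" for t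
    proof -
      have ge: "0 \<le> 1 / real (Suc k) + t * (X (\<phi> k) \<psi> - I \<psi>) + t\<^sup>2 * (D \<psi> / 2)" for k
        using m_le[OF test_add[OF \<phi>(1) \<psi>], of k t] \<phi>(2)[of k]
        unfolding J_add[OF \<phi>(1) \<psi>] by linarith
      have "(\<lambda>k. 1 / real (Suc k) + t * (X (\<phi> k) \<psi> - I \<psi>) + t\<^sup>2 * (D \<psi> / 2))
          \<longlonglongrightarrow> 0 + t * (Y - I \<psi>) + t\<^sup>2 * (D \<psi> / 2)"
        by (intro tendsto_add tendsto_mult tendsto_diff tendsto_const limX
            lim_1_over_n[THEN LIMSEQ_Suc])
      from LIMSEQ_le_const[OF this] ge show ?thesis by auto
    qed
    then have "Y - I \<psi> = 0"
      by (rule linear_coefficient_zero) (use D0 in simp)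
    then show ?thesis
      by (simp add: Y_def)
  qed
  with H show ?thesis
    unfolding is_torsion_def I_def by blast
qed

section \<open>Moments of the torsion function\<close>

lemma antiderivative_exists:
  fixes h :: "real \<Rightarrow> real"
  assumes "continuous_on UNIV h"
  obtains g where "\<And>t. (g has_real_derivative h t) (at t)" "g 0 = 0"
proof -
  have "\<exists>F. \<forall>x::real. -\<infinity> < ereal x \<longrightarrow> ereal x < \<infinity> \<longrightarrow> (F has_vector_derivative h x) (at x)"
    by (rule einterval_antiderivative) (use assms in \<open>auto simp: continuous_on_eq_continuous_at\<close>)
  then obtain F where F: "\<And>x. (F has_real_derivative h x) (at x)"
    by (auto simp: has_real_derivative_iff_has_vector_derivative)
  show ?thesis
  proof (rule that[of "\<lambda>t. F t - F 0"])
    show "((\<lambda>t. F t - F 0) has_real_derivative h t) (at t)" for t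
      by (auto intro!: derivative_eq_intros F)
  qed simp
qed

text \<open>Derivatives are compared on the open interval (0, t), where s^(b+1)/(b+1) has derivative
  s^b; the endpoints enter by continuity.\<close>

lemma antiderivative_le_powr:
  fixes g h :: "real \<Rightarrow> real"
  assumes g: "\<And>t. (g has_real_derivative h t) (at t)" "g 0 = 0" and b: "b > 0" and t: "t \<ge> 0"
  shows "(\<And>s. 0 < s \<Longrightarrow> s < t \<Longrightarrow> 0 \<le> h s) \<Longrightarrow> 0 \<le> g t"
    and "(\<And>s. 0 < s \<Longrightarrow> s < t \<Longrightarrow> h s \<le> s powr b) \<Longrightarrow> g t \<le> t powr (b + 1) / (b + 1)"
    and "(\<And>s. 0 < s \<Longrightarrow> s < t \<Longrightarrow> s powr b \<le> h s) \<Longrightarrow> t powr (b + 1) / (b + 1) \<le> g t"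
proof -
  let ?P = "\<lambda>s::real. s powr (b + 1) / (b + 1)"
  have cg: "continuous_on {0..t} g"
    using g(1) by (intro DERIV_continuous_on) (auto intro: has_field_derivative_at_within)
  have cP: "continuous_on {0..t} ?P"
    using b by (intro continuous_intros continuous_on_powr') auto
  have dP: "(?P has_real_derivative s powr b) (at s)" if "0 < s" for s
    using that b by (auto intro!: derivative_eq_intros)
  have P0: "?P 0 = 0" by simp
  show "0 \<le> g t" if "\<And>s. 0 < s \<Longrightarrow> s < t \<Longrightarrow> 0 \<le> h s"
    using DERIV_nonneg_imp_increasing_open[OF t _ cg] g that by metis
  show "g t \<le> t powr (b + 1) / (b + 1)" if "\<And>s. 0 < s \<Longrightarrow> s < t \<Longrightarrow> h s \<le> s powr b"
  proof -
    have "?P 0 - g 0 \<le> ?P t - g t"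
    proof (rule DERIV_nonneg_imp_increasing_open[OF t])
      show "\<exists>y. ((\<lambda>s. ?P s - g s) has_real_derivative y) (at s) \<and> 0 \<le> y" if s: "0 < s" "s < t" for s
        using DERIV_diff[OF dP[OF s(1)] g(1)] \<open>\<And>s. 0 < s \<Longrightarrow> s < t \<Longrightarrow> h s \<le> s powr b\<close>[OF s]
        by (intro exI[of _ "s powr b - h s"]) simp
    qed (intro continuous_intros cP cg)
    then show ?thesis using P0 g(2) by simp
  qed
  show "t powr (b + 1) / (b + 1) \<le> g t" if "\<And>s. 0 < s \<Longrightarrow> s < t \<Longrightarrow> s powr b \<le> h s"
  proof -
    have "g 0 - ?P 0 \<le> g t - ?P t"
    proof (rule DERIV_nonneg_imp_increasing_open[OF t])
      show "\<exists>y. ((\<lambda>s. g s - ?P s) has_real_derivative y) (at s) \<and> 0 \<le> y" if s: "0 < s" "s < t" for s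
        using DERIV_diff[OF g(1) dP[OF s(1)]] \<open>\<And>s. 0 < s \<Longrightarrow> s < t \<Longrightarrow> s powr b \<le> h s\<close>[OF s]
        by (intro exI[of _ "h s - s powr b"]) simp
    qed (intro continuous_intros cP cg)
    then show ?thesis using P0 g(2) by simp
  qed
qed

text \<open>The cap at M sits inside the derivative, so g is C^1 with bounded derivative: it is
  sgn(t)|t|^(b+1)/(b+1) for |t| \<le> M and affine beyond.\<close>

lemma truncated_power_antiderivative:
  fixes b M :: real
  assumes b: "b > 0" and M: "M \<ge> 0"
  obtains g where "\<And>t. (g has_real_derivative (min \<bar>t\<bar> M powr b)) (at t)" "g 0 = 0"
    "\<And>t. \<bar>g t\<bar> \<le> \<bar>t\<bar> powr (b + 1) / (b + 1)"
    "\<And>t. \<bar>t\<bar> \<le> M \<Longrightarrow> \<bar>g t\<bar> = \<bar>t\<bar> powr (b + 1) / (b + 1)"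
proof -
  let ?h = "\<lambda>t::real. min \<bar>t\<bar> M powr b"
  have "continuous_on UNIV ?h"
    using b M by (intro continuous_on_powr' continuous_intros) auto
  then obtain g where g: "\<And>t. (g has_real_derivative ?h t) (at t)" "g 0 = 0"
    using antiderivative_exists by blast
  \<comment> \<open>The derivative is even, so the reflection is a primitive as well, and bounds
    proved for t \<ge> 0 transfer to negative t.\<close>
  have g': "((\<lambda>t. - g (- t)) has_real_derivative ?h t) (at t)" for t
  proof -
    have "((\<lambda>t. - g (- t)) has_real_derivative - (?h (- t) * (- 1))) (at t)"
      by (intro DERIV_minus DERIV_chain2[OF g(1)] DERIV_ident derivative_intros)
    then show ?thesis by simp
  qed
  have le: "?h s \<le> s powr b" if "0 < s" for s
    using that b M by (intro powr_mono2) auto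
  have ge: "s powr b \<le> ?h s" if "0 < s" "s < t" "t \<le> M" for s t
    using that by simp
  have bound: "\<bar>f t\<bar> \<le> t powr (b + 1) / (b + 1)" "t \<le> M \<Longrightarrow> \<bar>f t\<bar> = t powr (b + 1) / (b + 1)"
    if f: "\<And>t. (f has_real_derivative ?h t) (at t)" "f 0 = 0" and t: "t \<ge> 0" for f t
  proof -
    note * = antiderivative_le_powr[OF f b t]
    have "0 \<le> f t"
      by (rule *(1)) simp
    moreover have u: "f t \<le> t powr (b + 1) / (b + 1)"
      by (rule *(2)) (rule le)
    ultimately show "\<bar>f t\<bar> \<le> t powr (b + 1) / (b + 1)"
      by simp
    show "\<bar>f t\<bar> = t powr (b + 1) / (b + 1)" if "t \<le> M"
    proof -
      have "t powr (b + 1) / (b + 1) \<le> f t"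
        by (rule *(3)) (rule ge[OF _ _ that])
      with u \<open>0 \<le> f t\<close> show ?thesis by linarith
    qed
  qed
  have b1: "\<bar>g t\<bar> \<le> \<bar>t\<bar> powr (b + 1) / (b + 1)" for t
    using bound(1)[OF g, of t] bound(1)[OF g', of "- t"] g(2) by (cases "t \<ge> 0") auto
  have b2: "\<bar>g t\<bar> = \<bar>t\<bar> powr (b + 1) / (b + 1)" if "\<bar>t\<bar> \<le> M" for t
    using bound(2)[OF g, of t] bound(2)[OF g', of "- t"] g(2) that by (cases "t \<ge> 0") auto
  show ?thesis
    by (rule that[OF g b1 b2])
qed

text \<open>Isolates what the estimates use: a weak solution and a positive Poincare constant.
  \<open>torsion\<close> and \<open>lambda1\<close> enter only by interpretation.\<close>

locale torsion_problem =
  fixes \<Omega> :: "'a::euclidean_space set" and v :: "'a \<Rightarrow> real" and G :: "'a \<Rightarrow> 'a" and lam :: real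
  assumes domain: "\<Omega> \<in> sets lebesgue" "emeasure lebesgue \<Omega> < \<infinity>"
    and v: "H01 \<Omega> v G"
    and weak: "\<And>\<phi>. test_fun \<Omega> \<phi> \<Longrightarrow>
      (LINT x|lebesgue. G x \<bullet> grad \<phi> x) = (LINT x:\<Omega>|lebesgue. \<phi> x)"
    and lam: "lam > 0"
    and poincare: "\<And>u H. H01 \<Omega> u H \<Longrightarrow>
      lam * (LINT x|lebesgue. (u x)\<^sup>2) \<le> (LINT x|lebesgue. (norm (H x))\<^sup>2)"
begin

lemmas v_square_integrable = H01_square_integrable[OF v]

lemma v_measurable [measurable]: "v \<in> borel_measurable lebesgue"
  by (rule square_integrable_measurable[OF v_square_integrable(1)])

text \<open>The Poincare inequality for \<open>g(v)\<close> and the equation tested with \<open>\<psi>(v)\<close>, coupled through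
  \<open>g'\<^sup>2 = \<psi>'\<close>.\<close>

lemma poincare_comp:
  fixes g \<psi> h :: "real \<Rightarrow> real"
  assumes g: "\<And>t. (g has_real_derivative h t) (at t)" "g 0 = 0"
    and \<psi>: "\<And>t. (\<psi> has_real_derivative (h t)\<^sup>2) (at t)" "\<psi> 0 = 0"
    and h: "continuous_on UNIV h" "\<And>t. \<bar>h t\<bar> \<le> L"
    and w: "integrable lebesgue w" "\<And>x. 0 \<le> w x" "\<And>x. \<bar>\<psi> (v x)\<bar> \<le> w x"
  shows "integrable lebesgue (\<lambda>x. (g (v x))\<^sup>2)"
    and "lam * (LINT x|lebesgue. (g (v x))\<^sup>2) \<le> (LINT x|lebesgue. w x)"
proof -
  have h2: "continuous_on UNIV (\<lambda>t. (h t)\<^sup>2)" "\<And>t. \<bar>(h t)\<^sup>2\<bar> \<le> L\<^sup>2"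
    using h power_mono[OF h(2) abs_ge_zero, where n=2] by (auto intro!: continuous_intros)
  have Hg: "H01 \<Omega> (\<lambda>x. g (v x)) (\<lambda>x. h (v x) *\<^sub>R G x)"
    by (rule H01_chain_rule[OF v g h])
  have H\<psi>: "H01 \<Omega> (\<lambda>x. \<psi> (v x)) (\<lambda>x. (h (v x))\<^sup>2 *\<^sub>R G x)"
    by (rule H01_chain_rule[OF v \<psi> h2])
  show "integrable lebesgue (\<lambda>x. (g (v x))\<^sup>2)"
    using square_integrable_integrable[OF H01_square_integrable(1)[OF Hg]] by simp
  have "lam * (LINT x|lebesgue. (g (v x))\<^sup>2) \<le> (LINT x|lebesgue. (norm (h (v x) *\<^sub>R G x))\<^sup>2)"
    by (rule poincare[OF Hg])
  also have "\<dots> = (LINT x|lebesgue. G x \<bullet> ((h (v x))\<^sup>2 *\<^sub>R G x))"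
    by (simp add: power_mult_distrib power2_norm_eq_inner)
  also have "\<dots> = (LINT x:\<Omega>|lebesgue. \<psi> (v x))"
    by (rule weak_form_H01[OF domain v_square_integrable(2) weak H\<psi>])
  also have "\<dots> = (LINT x|lebesgue. \<psi> (v x) \<bullet> indicator \<Omega> x)"
    by (rule set_lebesgue_integral_eq_inner)
  also have "\<dots> \<le> (LINT x|lebesgue. w x)"
  proof (rule integral_mono)
    show "integrable lebesgue (\<lambda>x. \<psi> (v x) \<bullet> indicator \<Omega> x)"
      by (rule square_integrable_inner[OF H01_square_integrable(1)[OF H\<psi>]
            square_integrable_indicator(1)[OF domain]])
    show "\<psi> (v x) \<bullet> indicator \<Omega> x \<le> w x" for x
      using w(2)[of x] w(3)[of x] by (auto simp: indicator_def)
  qed (rule w)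
  finally show "lam * (LINT x|lebesgue. (g (v x))\<^sup>2) \<le> (LINT x|lebesgue. w x)" .
qed

text \<open>For h = |t|^a with a = (p - 1)/2, the primitive of h^2 has size |t|^p/p, while g^2 =
  4|t|^(p+1)/(p+1)^2; the quotient of the two coefficients is the constant. Capping h at level k
  makes \<open>poincare_comp\<close> applicable with bounds uniform in k, and Fatou then delivers
  integrability together with the estimate.\<close>

lemma moment_step:
  assumes p: "p \<ge> 1" and int: "integrable lebesgue (\<lambda>x. \<bar>v x\<bar> powr p)"
  shows "integrable lebesgue (\<lambda>x. \<bar>v x\<bar> powr (p + 1))"
    and "lam * (LINT x|lebesgue. \<bar>v x\<bar> powr (p + 1))
      \<le> (p + 1)\<^sup>2 / (4 * p) * (LINT x|lebesgue. \<bar>v x\<bar> powr p)"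
proof -
  have "integrable lebesgue (\<lambda>x. \<bar>v x\<bar> powr (p + 1)) \<and>
      lam * (LINT x|lebesgue. \<bar>v x\<bar> powr (p + 1))
      \<le> (p + 1)\<^sup>2 / (4 * p) * (LINT x|lebesgue. \<bar>v x\<bar> powr p)"
  \<comment> \<open>For p = 1 the exponent a is 0, and as \<open>0 powr 0 = 0\<close> the function h
    would jump at 0; identity functions serve instead.\<close>
  proof (cases "p = 1")
    case True
    have int1: "integrable lebesgue (\<lambda>x. \<bar>v x\<bar>)"
      using int True by simp
    have "integrable lebesgue (\<lambda>x. (v x)\<^sup>2)"
      and "lam * (LINT x|lebesgue. (v x)\<^sup>2) \<le> (LINT x|lebesgue. \<bar>v x\<bar>)"
      using poincare_comp[of "\<lambda>t. t" "\<lambda>t. 1" "\<lambda>t. t" 1 "\<lambda>x. \<bar>v x\<bar>"] int1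
      by (auto intro!: derivative_eq_intros)
    moreover have "\<bar>v x\<bar> powr 2 = (v x)\<^sup>2" for x
      by simp
    ultimately show ?thesis
      using True by simp
  next
    case False
    define a where "a = (p - 1) / 2"
    have a: "a > 0" "a + 1 = (p + 1) / 2" "2 * a = p - 1" "2 * a + 1 = p"
      using p False by (simp_all add: a_def field_simps)
    define C where "C = (LINT x|lebesgue. \<bar>v x\<bar> powr p) / p / lam"
    have "\<exists>g. (integrable lebesgue (\<lambda>x. (g (v x))\<^sup>2) \<and> (LINT x|lebesgue. (g (v x))\<^sup>2) \<le> C) \<and>
        (\<forall>t. \<bar>t\<bar> \<le> real k \<longrightarrow> \<bar>g t\<bar> = \<bar>t\<bar> powr (a + 1) / (a + 1))" for k :: nat
    proof -
      have k0: "0 \<le> real k" by simp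
      obtain g where g: "\<And>t. (g has_real_derivative (min \<bar>t\<bar> (real k) powr a)) (at t)" "g 0 = 0"
        "\<And>t. \<bar>g t\<bar> \<le> \<bar>t\<bar> powr (a + 1) / (a + 1)"
        "\<And>t. \<bar>t\<bar> \<le> real k \<Longrightarrow> \<bar>g t\<bar> = \<bar>t\<bar> powr (a + 1) / (a + 1)"
        using truncated_power_antiderivative[OF a(1) k0] by blast
      have a2: "2 * a > 0" using a(1) by simp
      obtain \<psi> where \<psi>: "\<And>t. (\<psi> has_real_derivative (min \<bar>t\<bar> (real k) powr (2 * a))) (at t)" "\<psi> 0 = 0"
        "\<And>t. \<bar>\<psi> t\<bar> \<le> \<bar>t\<bar> powr (2 * a + 1) / (2 * a + 1)"
        "\<And>t. \<bar>t\<bar> \<le> real k \<Longrightarrow> \<bar>\<psi> t\<bar> = \<bar>t\<bar> powr (2 * a + 1) / (2 * a + 1)"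
        using truncated_power_antiderivative[OF a2 k0] by blast
      have sqr: "(min \<bar>t\<bar> (real k) powr a)\<^sup>2 = min \<bar>t\<bar> (real k) powr (2 * a)" for t
        by (simp add: power2_eq_square flip: powr_add)
      have c: "continuous_on UNIV (\<lambda>t. min \<bar>t\<bar> (real k) powr a)"
        using a by (intro continuous_on_powr' continuous_intros) auto
      have L: "\<bar>min \<bar>t\<bar> (real k) powr a\<bar> \<le> real k powr a" for t
        using a by (simp add: powr_mono2)
      have *: "integrable lebesgue (\<lambda>x. (g (v x))\<^sup>2)"
        "lam * (LINT x|lebesgue. (g (v x))\<^sup>2) \<le> (LINT x|lebesgue. \<bar>v x\<bar> powr p / p)"
        using poincare_comp[OF g(1,2) \<psi>(1)[folded sqr] \<psi>(2) c L, of "\<lambda>x. \<bar>v x\<bar> powr p / p"]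
          int p \<psi>(3)[unfolded a(4)] by auto
      have "(LINT x|lebesgue. (g (v x))\<^sup>2) \<le> C"
        using *(2) lam p by (simp add: C_def field_simps)
      with *(1) g(4) show ?thesis by blast
    qed
    then have "\<forall>k::nat. \<exists>g. (integrable lebesgue (\<lambda>x. (g (v x))\<^sup>2) \<and> (LINT x|lebesgue. (g (v x))\<^sup>2) \<le> C) \<and>
        (\<forall>t. \<bar>t\<bar> \<le> real k \<longrightarrow> \<bar>g t\<bar> = \<bar>t\<bar> powr (a + 1) / (a + 1))"
      by blast
    from choice[OF this] obtain g :: "nat \<Rightarrow> real \<Rightarrow> real" where
      g: "\<And>k. integrable lebesgue (\<lambda>x. (g k (v x))\<^sup>2)" "\<And>k. (LINT x|lebesgue. (g k (v x))\<^sup>2) \<le> C"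
        "\<And>k t. \<bar>t\<bar> \<le> real k \<Longrightarrow> \<bar>g k t\<bar> = \<bar>t\<bar> powr (a + 1) / (a + 1)"
      by blast
    \<comment> \<open>This is (1/(a + 1))^2, the coefficient of |t|^(p+1) in g^2 below the
      cap.\<close>
    define q where "q = 4 / (p + 1)\<^sup>2"
    have q: "q > 0"
      using p by (simp add: q_def)
    \<comment> \<open>Each value v x lies below the cap from some k on, so the sequence is
      eventually constant.\<close>
    have lim: "(\<lambda>k. (g k (v x))\<^sup>2) \<longlonglongrightarrow> q * \<bar>v x\<bar> powr (p + 1)" for x
    proof (rule tendsto_eventually)
      obtain N :: nat where N: "\<bar>v x\<bar> \<le> real N"
        using real_arch_simple by blast
      have "(g k (v x))\<^sup>2 = q * \<bar>v x\<bar> powr (p + 1)" if "k \<ge> N" for k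
      proof -
        have "(g k (v x))\<^sup>2 = (\<bar>v x\<bar> powr ((p + 1) / 2) / ((p + 1) / 2))\<^sup>2"
          using g(3)[of "v x" k] N that unfolding a(2) by (metis of_nat_le_iff order_trans power2_abs)
        also have "\<dots> = (\<bar>v x\<bar> powr ((p + 1) / 2))\<^sup>2 * q"
          by (simp add: q_def power2_eq_square field_simps)
        also have "(\<bar>v x\<bar> powr ((p + 1) / 2))\<^sup>2 = \<bar>v x\<bar> powr (p + 1)"
          by (simp add: power2_eq_square flip: powr_add)
        finally show ?thesis by simp
      qed
      then show "\<forall>\<^sub>F k in sequentially. (g k (v x))\<^sup>2 = q * \<bar>v x\<bar> powr (p + 1)"
        unfolding eventually_sequentially by blast
    qed
    have meas: "(\<lambda>x. q * \<bar>v x\<bar> powr (p + 1)) \<in> borel_measurable lebesgue"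
      by measurable
    note fatou = integrable_fatou_bound[OF g(1) zero_le_power2
        always_eventually[OF allI[OF g(2)]] meas AE_I2[OF lim]]
    have le: "(LINT x|lebesgue. q * \<bar>v x\<bar> powr (p + 1)) \<le> C"
      by (rule fatou(2))
    have i: "integrable lebesgue (\<lambda>x. \<bar>v x\<bar> powr (p + 1))"
      using fatou(1) q by simp
    have "q * lam * (LINT x|lebesgue. \<bar>v x\<bar> powr (p + 1)) \<le> (LINT x|lebesgue. \<bar>v x\<bar> powr p) / p"
      using le lam p by (simp add: C_def field_simps)
    then have "lam * (LINT x|lebesgue. \<bar>v x\<bar> powr (p + 1)) \<le> (LINT x|lebesgue. \<bar>v x\<bar> powr p) / p / q"
      using q p by (simp add: field_simps)
    also have "\<dots> = (p + 1)\<^sup>2 / (4 * p) * (LINT x|lebesgue. \<bar>v x\<bar> powr p)"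
      by (simp add: q_def mult.commute)
    finally show ?thesis using i by blast
  qed
  then show "integrable lebesgue (\<lambda>x. \<bar>v x\<bar> powr (p + 1))"
    and "lam * (LINT x|lebesgue. \<bar>v x\<bar> powr (p + 1))
      \<le> (p + 1)\<^sup>2 / (4 * p) * (LINT x|lebesgue. \<bar>v x\<bar> powr p)"
    by simp_all
qed

end

text \<open>The product of (q + 1)^2/(4q) over q = p, ..., p + n - 1. The denominators cancel one
  copy of p + j for 0 < j < n; the two ends leave the quotient (p + n)/p.\<close>

definition moment_const :: "real \<Rightarrow> nat \<Rightarrow> real" where
  "moment_const p n = (p + real n) / (4 ^ n * p) * (\<Prod>j=1..n. p + real j)"

lemma moment_const_0: "p \<ge> 1 \<Longrightarrow> moment_const p 0 = 1"
  by (simp add: moment_const_def)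

lemma moment_const_Suc:
  assumes "p \<ge> 1"
  shows "moment_const p (Suc n) = (p + real n + 1)\<^sup>2 / (4 * (p + real n)) * moment_const p n"
proof -
  define P where "P = (\<Prod>j=1..n. p + real j)"
  have "(\<Prod>j=1..Suc n. p + real j) = P * (p + real n + 1)"
    by (simp add: P_def algebra_simps)
  moreover have "p + real n \<noteq> 0" "p \<noteq> 0"
    using assms by auto
  ultimately show ?thesis
    unfolding moment_const_def P_def[symmetric]
    by (simp add: divide_simps power2_eq_square) (simp add: algebra_simps)
qed

lemma moment_const_nonneg: "p \<ge> 1 \<Longrightarrow> 0 \<le> moment_const p n"
  unfolding moment_const_def by (intro mult_nonneg_nonneg divide_nonneg_nonneg prod_nonneg) auto

text \<open>Unit steps from a base exponent in [1, 2] reach every p \<ge> 1, and in the base range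
  the moments are controlled by v^2 and |\<Omega>|.\<close>

lemma real_ge_1_split:
  fixes p :: real
  assumes "p \<ge> 1"
  obtains r and n :: nat where "1 \<le> r" "r \<le> 2" "p = r + real n"
proof (rule that)
  define n where "n = nat \<lfloor>p - 1\<rfloor>"
  have n: "real n = of_int \<lfloor>p - 1\<rfloor>"
    using assms by (simp add: n_def)
  show "1 \<le> p - real n" "p - real n \<le> 2"
    unfolding n by linarith+
  show "p = p - real n + real n" by simp
qed

section \<open>Moments of every order p \<ge> 1, normalised by powers of \<lambda>\<close>

context torsion_problem
begin

lemma measure_domain: "integrable lebesgue (indicator \<Omega> :: 'a \<Rightarrow> real)"
    "(LINT x|lebesgue. (indicator \<Omega> x :: real)) = measure lebesgue \<Omega>"
  using domain by (auto simp: integrable_indicator_iff less_top)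

lemma integrable_v_square: "integrable lebesgue (\<lambda>x. (v x)\<^sup>2)"
  using square_integrable_integrable[OF v_square_integrable(1)] by simp

text \<open>|v|^r \<le> 1 + v^2, and v vanishes off \<Omega>, so the constant 1 becomes the
  integrable indicator of \<Omega>.\<close>

lemma integrable_low_moment:
  assumes r: "1 \<le> r" "r \<le> 2"
  shows "integrable lebesgue (\<lambda>x. \<bar>v x\<bar> powr r)"
proof (rule Bochner_Integration.integrable_bound)
  show "integrable lebesgue (\<lambda>x. indicator \<Omega> x + (v x)\<^sup>2)"
    using measure_domain(1) integrable_v_square by auto
  show "(\<lambda>x. \<bar>v x\<bar> powr r) \<in> borel_measurable lebesgue"
    by measurable
  show "AE x in lebesgue. norm (\<bar>v x\<bar> powr r) \<le> norm (indicator \<Omega> x + (v x)\<^sup>2)"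
    using H01_AE_zero_outside[OF v]
  proof eventually_elim
    case (elim x)
    show ?case
    proof (cases "x \<in> \<Omega>")
      case True
      have "\<bar>v x\<bar> powr r \<le> 1 + (v x)\<^sup>2"
      proof (cases "\<bar>v x\<bar> \<le> 1")
        case True
        then have "\<bar>v x\<bar> powr r \<le> 1"
          using r by (simp add: powr_le1)
        then show ?thesis
          by (smt (verit) zero_le_power2)
      next
        case False
        then have "\<bar>v x\<bar> powr r \<le> \<bar>v x\<bar> powr 2"
          using r by (intro powr_mono) auto
        then show ?thesis by simp
      qed
      with True show ?thesis by simp
    next
      case False
      with elim show ?thesis by simp
    qed
  qed
qed

text \<open>The step p = 1 bounds \<lambda> times the integral of v^2 by that of |v|. After another
  factor \<lambda>, the pointwise bound 2\<lambda>|v| \<le> \<lambda>^2 v^2 + 1 on \<Omega> brings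
  the left side back with factor 1/2, where it is absorbed.\<close>

lemma second_moment_bound: "lam\<^sup>2 * (LINT x|lebesgue. (v x)\<^sup>2) \<le> measure lebesgue \<Omega>"
proof -
  have int1: "integrable lebesgue (\<lambda>x. \<bar>v x\<bar>)"
    using integrable_low_moment[of 1] by simp
  have step: "lam * (LINT x|lebesgue. (v x)\<^sup>2) \<le> (LINT x|lebesgue. \<bar>v x\<bar>)"
    using moment_step(2)[of 1] int1 by simp
  have "lam * (LINT x|lebesgue. \<bar>v x\<bar>) = (LINT x|lebesgue. lam * \<bar>v x\<bar>)"
    by simp
  also have "\<dots> \<le> (LINT x|lebesgue. (lam\<^sup>2 * (v x)\<^sup>2 + indicator \<Omega> x) / 2)"
  proof (rule integral_mono_AE)
    show "AE x in lebesgue. lam * \<bar>v x\<bar> \<le> (lam\<^sup>2 * (v x)\<^sup>2 + indicator \<Omega> x) / 2"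
      using H01_AE_zero_outside[OF v]
    proof eventually_elim
      case (elim x)
      have "2 * (lam * \<bar>v x\<bar>) * 1 \<le> (lam * \<bar>v x\<bar>)\<^sup>2 + 1\<^sup>2"
        by (rule sum_squares_bound)
      with elim show ?case
        by (cases "x \<in> \<Omega>") (auto simp: power_mult_distrib)
    qed
  qed (use int1 integrable_v_square measure_domain in auto)
  also have "\<dots> = (lam\<^sup>2 * (LINT x|lebesgue. (v x)\<^sup>2) + measure lebesgue \<Omega>) / 2"
    using integrable_v_square measure_domain by simp
  finally have "lam * (LINT x|lebesgue. \<bar>v x\<bar>)
      \<le> (lam\<^sup>2 * (LINT x|lebesgue. (v x)\<^sup>2) + measure lebesgue \<Omega>) / 2" .
  moreover have "lam\<^sup>2 * (LINT x|lebesgue. (v x)\<^sup>2) \<le> lam * (LINT x|lebesgue. \<bar>v x\<bar>)"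
    using mult_left_mono[OF step, of lam] lam by (simp add: power2_eq_square mult.assoc)
  ultimately show ?thesis by simp
qed

text \<open>By the weighted Young inequality, (\<lambda>|v|)^r is at most the convex combination of
  (\<lambda>|v|)^2 and 1 with weights r/2 and 1 - r/2; each of these has integral at most |\<Omega>|
  over \<Omega>.\<close>

lemma low_moment_bound:
  assumes r: "1 \<le> r" "r \<le> 2"
  shows "lam powr r * (LINT x|lebesgue. \<bar>v x\<bar> powr r) \<le> measure lebesgue \<Omega>"
proof -
  have "lam powr r * (LINT x|lebesgue. \<bar>v x\<bar> powr r) = (LINT x|lebesgue. lam powr r * \<bar>v x\<bar> powr r)"
    by simp
  also have "\<dots> \<le> (LINT x|lebesgue. r / 2 * (lam\<^sup>2 * (v x)\<^sup>2) + (1 - r / 2) * indicator \<Omega> x)"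
  proof (rule integral_mono_AE)
    show "AE x in lebesgue. lam powr r * \<bar>v x\<bar> powr r
        \<le> r / 2 * (lam\<^sup>2 * (v x)\<^sup>2) + (1 - r / 2) * indicator \<Omega> x"
      using H01_AE_zero_outside[OF v]
    proof eventually_elim
      case (elim x)
      show ?case
      proof (cases "v x = 0")
        case True
        then show ?thesis using r by simp
      next
        case False
        with elim have "x \<in> \<Omega>" by auto
        define y where "y = lam * \<bar>v x\<bar>"
        have y: "y > 0"
          using lam False by (simp add: y_def)
        have "y\<^sup>2 powr (r / 2) * 1 powr (1 - r / 2) \<le> r / 2 * y\<^sup>2 + (1 - r / 2) * 1"
          using r y by (intro Youngs_inequality_0) auto
        moreover have "y\<^sup>2 powr (r / 2) = y powr r"
          using y by (simp add: powr_powr flip: powr_numeral)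
        moreover have "y powr r = lam powr r * \<bar>v x\<bar> powr r"
          using lam by (simp add: y_def powr_mult)
        ultimately show ?thesis
          using \<open>x \<in> \<Omega>\<close> by (simp add: y_def power_mult_distrib)
      qed
    qed
  qed (use integrable_low_moment[OF r] integrable_v_square measure_domain in auto)
  also have "\<dots> = r / 2 * (lam\<^sup>2 * (LINT x|lebesgue. (v x)\<^sup>2)) + (1 - r / 2) * measure lebesgue \<Omega>"
    using integrable_v_square measure_domain by simp
  also have "\<dots> \<le> r / 2 * measure lebesgue \<Omega> + (1 - r / 2) * measure lebesgue \<Omega>"
    using second_moment_bound r by (intro add_right_mono mult_left_mono) auto
  also have "\<dots> = measure lebesgue \<Omega>"
    by (simp add: algebra_simps)
  finally show ?thesis .
qed

lemma integrable_moment_add_nat: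
  assumes "p \<ge> 1" "integrable lebesgue (\<lambda>x. \<bar>v x\<bar> powr p)"
  shows "integrable lebesgue (\<lambda>x. \<bar>v x\<bar> powr (p + real n))"
proof (induction n)
  case (Suc n)
  then have "integrable lebesgue (\<lambda>x. \<bar>v x\<bar> powr (p + real n + 1))"
    using assms(1) by (intro moment_step) auto
  then show ?case by (simp add: algebra_simps)
qed (use assms in simp)

lemma integrable_moment:
  assumes "p \<ge> 1"
  shows "integrable lebesgue (\<lambda>x. \<bar>v x\<bar> powr p)"
proof -
  obtain r and n :: nat where r: "1 \<le> r" "r \<le> 2" "p = r + real n"
    using real_ge_1_split[OF assms] by blast
  show ?thesis
    unfolding r(3) by (rule integrable_moment_add_nat[OF r(1) integrable_low_moment[OF r(1,2)]])
qed

text \<open>The power of \<lambda> keeps pace with the exponent: each \<open>moment_step\<close>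
  consumes one \<lambda> and supplies one factor of \<open>moment_const\<close>.\<close>

lemma moment_iterate:
  assumes p: "p \<ge> 1"
  shows "lam powr (p + real n) * (LINT x|lebesgue. \<bar>v x\<bar> powr (p + real n))
    \<le> moment_const p n * (lam powr p * (LINT x|lebesgue. \<bar>v x\<bar> powr p))"
proof (induction n)
  case 0
  then show ?case using p by (simp add: moment_const_0)
next
  case (Suc n)
  define q where "q = p + real n"
  define a where "a = (q + 1)\<^sup>2 / (4 * q)"
  have q: "q \<ge> 1" using p by (simp add: q_def)
  have a: "a \<ge> 0" using q by (simp add: a_def)
  have "lam powr (q + 1) * (LINT x|lebesgue. \<bar>v x\<bar> powr (q + 1))
      = lam powr q * (lam * (LINT x|lebesgue. \<bar>v x\<bar> powr (q + 1)))"
    using lam by (simp add: powr_add)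
  also have "\<dots> \<le> lam powr q * (a * (LINT x|lebesgue. \<bar>v x\<bar> powr q))"
    unfolding a_def by (intro mult_left_mono moment_step(2) integrable_moment q) simp
  also have "\<dots> = a * (lam powr q * (LINT x|lebesgue. \<bar>v x\<bar> powr q))"
    by simp
  also have "\<dots> \<le> a * (moment_const p n * (lam powr p * (LINT x|lebesgue. \<bar>v x\<bar> powr p)))"
    using Suc a by (intro mult_left_mono) (simp_all add: q_def)
  also have "\<dots> = moment_const p (Suc n) * (lam powr p * (LINT x|lebesgue. \<bar>v x\<bar> powr p))"
    by (simp add: moment_const_Suc[OF p] a_def q_def)
  also have "q + 1 = p + real (Suc n)"
    by (simp add: q_def)
  finally show ?case .
qed

lemma set_integral_moment:
  "(LINT x:\<Omega>|lebesgue. \<bar>v x\<bar> powr p) = (LINT x|lebesgue. \<bar>v x\<bar> powr p)"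
  unfolding set_lebesgue_integral_def
proof (rule integral_cong_AE)
  show "AE x in lebesgue. indicat_real \<Omega> x *\<^sub>R \<bar>v x\<bar> powr p = \<bar>v x\<bar> powr p"
    using H01_AE_zero_outside[OF v] by eventually_elim (auto simp: indicator_def)
qed (use domain in measurable)

end

section \<open>Suprema over domains\<close>

text \<open>If no function of \<open>H\<^sub>0\<^sup>1(\<Omega>)\<close> has nonzero \<open>L\<^sup>2\<close> norm, \<open>lambda1 \<Omega>\<close> is the junk value
  \<open>Inf {}\<close>, but then the torsion function vanishes almost everywhere. This makes it unnecessary
  to exhibit a nonzero test function.\<close>

lemma Fp_zero_or_torsion_problem:
  fixes \<Omega> :: "'a::euclidean_space set"
  assumes \<Omega>: "\<Omega> \<in> sets lebesgue" "emeasure lebesgue \<Omega> < \<infinity>"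
  shows "(\<forall>p. Fp p \<Omega> = 0) \<or> (\<exists>G. torsion_problem \<Omega> (torsion \<Omega>) G (lambda1 \<Omega>))"
proof -
  define R where "R = {(LINT x|lebesgue. (norm (G x))\<^sup>2) / (LINT x|lebesgue. (u x)\<^sup>2) | u G.
                     H01 \<Omega> u G \<and> (LINT x|lebesgue. (u x)\<^sup>2) \<noteq> 0}"
  have lambda: "lambda1 \<Omega> = Inf R"
    by (simp add: lambda1_def R_def)
  have torsion: "is_torsion \<Omega> (torsion \<Omega>)"
    if "c > 0" "\<And>u G. H01 \<Omega> u G \<Longrightarrow>
      c * (LINT x|lebesgue. (u x)\<^sup>2) \<le> (LINT x|lebesgue. (norm (G x))\<^sup>2)" for c
    unfolding torsion_def by (rule someI_ex[OF torsion_exists[OF \<Omega> that]])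
  show ?thesis
  proof (cases "R = {}")
    case True
    then have zero: "(LINT x|lebesgue. (u x)\<^sup>2) = 0" if "H01 \<Omega> u G" for u G
      using that unfolding R_def by blast
    \<comment> \<open>Every L^2 norm is 0 here, so the Poincare inequality holds with any positive
      constant, and 1 serves to produce a torsion function.\<close>
    have "is_torsion \<Omega> (torsion \<Omega>)"
      by (rule torsion[of 1]) (simp_all add: zero)
    then obtain G where G: "H01 \<Omega> (torsion \<Omega>) G"
      unfolding is_torsion_def by blast
    have "integrable lebesgue (\<lambda>x. (torsion \<Omega> x)\<^sup>2)"
      using square_integrable_integrable[OF H01_square_integrable(1)[OF G]] by simp
    then have "AE x in lebesgue. (torsion \<Omega> x)\<^sup>2 = 0"
      using zero[OF G] by (subst (asm) integral_nonneg_eq_0_iff_AE) auto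
    then have ae: "AE x in lebesgue. torsion \<Omega> x = 0"
      by simp
    have "(LINT x:\<Omega>|lebesgue. \<bar>torsion \<Omega> x\<bar> powr p) = 0" for p
      unfolding set_lebesgue_integral_def
      by (rule integral_eq_zero_AE) (use ae in eventually_elim, simp)
    then show ?thesis
      by (simp add: Fp_def)
  next
    case False
    have R0: "0 \<le> r" if "r \<in> R" for r
      using that by (auto simp: R_def)
    then have bdd: "bdd_below R"
      unfolding bdd_below_def by blast
    have "0 \<le> lambda1 \<Omega>"
      unfolding lambda using False R0 by (rule cInf_greatest)
    have poincare: "lambda1 \<Omega> * (LINT x|lebesgue. (u x)\<^sup>2) \<le> (LINT x|lebesgue. (norm (G x))\<^sup>2)"
      if "H01 \<Omega> u G" for u G
    proof (cases "(LINT x|lebesgue. (u x)\<^sup>2) = 0")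
      case False
      moreover have "(LINT x|lebesgue. (u x)\<^sup>2) \<ge> 0"
        by simp
      ultimately have pos: "(LINT x|lebesgue. (u x)\<^sup>2) > 0"
        by linarith
      have "(LINT x|lebesgue. (norm (G x))\<^sup>2) / (LINT x|lebesgue. (u x)\<^sup>2) \<in> R"
        using that False unfolding R_def by blast
      then have "lambda1 \<Omega> \<le> (LINT x|lebesgue. (norm (G x))\<^sup>2) / (LINT x|lebesgue. (u x)\<^sup>2)"
        unfolding lambda using bdd by (rule cInf_lower)
      then show ?thesis
        using pos by (simp add: pos_le_divide_eq)
    qed simp
    show ?thesis
    proof (cases "lambda1 \<Omega> = 0")
      case True
      then show ?thesis by (simp add: Fp_def)
    next
      case False
      with \<open>0 \<le> lambda1 \<Omega>\<close> have pos: "lambda1 \<Omega> > 0"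
        by simp
      have "is_torsion \<Omega> (torsion \<Omega>)"
        by (rule torsion[OF pos poincare])
      then obtain G where "H01 \<Omega> (torsion \<Omega>) G"
        "\<And>\<phi>. test_fun \<Omega> \<phi> \<Longrightarrow>
         (LINT x|lebesgue. G x \<bullet> grad \<phi> x) = (LINT x:\<Omega>|lebesgue. \<phi> x)"
        unfolding is_torsion_def by blast
      then have "torsion_problem \<Omega> (torsion \<Omega>) G (lambda1 \<Omega>)"
        using \<Omega> pos poincare by unfold_locales
      then show ?thesis by blast
    qed
  qed
qed

text \<open>Clears the roots from the formula for F_p and leaves the form in which
  \<open>moment_iterate\<close> and \<open>low_moment_bound\<close> apply.\<close>

lemma (in torsion_problem) powr_normalized_moment:
  assumes "p \<ge> 1"
  shows "((LINT x:\<Omega>|lebesgue. \<bar>v x\<bar> powr p) powr (1/p) * lam / measure lebesgue \<Omega> powr (1/p)) powr p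
    = lam powr p * (LINT x|lebesgue. \<bar>v x\<bar> powr p) / measure lebesgue \<Omega>"
proof -
  have "0 \<le> (LINT x|lebesgue. \<bar>v x\<bar> powr p)"
    by simp
  then show ?thesis
    using assms lam by (simp add: set_integral_moment powr_mult powr_divide powr_powr)
qed

lemma
  fixes \<Omega> :: "'a::euclidean_space set"
  assumes \<Omega>: "\<Omega> \<in> sets lebesgue" "0 < emeasure lebesgue \<Omega>" "emeasure lebesgue \<Omega> < \<infinity>"
    and p: "p \<ge> 1"
  shows Fp_nonneg: "0 \<le> Fp p \<Omega>"
    and Fp_powr_add_nat: "Fp (p + real n) \<Omega> powr (p + real n) \<le> moment_const p n * Fp p \<Omega> powr p"
    and Fp_le_1: "p \<le> 2 \<Longrightarrow> Fp p \<Omega> \<le> 1"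
proof -
  have "0 \<le> Fp p \<Omega> \<and>
      Fp (p + real n) \<Omega> powr (p + real n) \<le> moment_const p n * Fp p \<Omega> powr p \<and>
      (p \<le> 2 \<longrightarrow> Fp p \<Omega> \<le> 1)"
    using Fp_zero_or_torsion_problem[OF \<Omega>(1,3)]
  proof
    assume "\<forall>p. Fp p \<Omega> = 0"
    then show ?thesis by simp
  next
    assume "\<exists>G. torsion_problem \<Omega> (torsion \<Omega>) G (lambda1 \<Omega>)"
    then obtain G where "torsion_problem \<Omega> (torsion \<Omega>) G (lambda1 \<Omega>)" by blast
    then interpret torsion_problem \<Omega> "torsion \<Omega>" G "lambda1 \<Omega>" .
    let ?I = "\<lambda>q. LINT x|lebesgue. \<bar>torsion \<Omega> x\<bar> powr q"
    have m: "measure lebesgue \<Omega> > 0"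
      using \<Omega> by (auto simp: measure_def enn2real_positive_iff)
    have nonneg: "0 \<le> Fp p \<Omega>"
      using lam by (simp add: Fp_def)
    have F: "Fp q \<Omega> powr q = lambda1 \<Omega> powr q * ?I q / measure lebesgue \<Omega>" if "q \<ge> 1" for q
      unfolding Fp_def using that by (rule powr_normalized_moment)
    have "Fp (p + real n) \<Omega> powr (p + real n) \<le> moment_const p n * Fp p \<Omega> powr p"
    proof -
      have "Fp (p + real n) \<Omega> powr (p + real n)
          = lambda1 \<Omega> powr (p + real n) * ?I (p + real n) / measure lebesgue \<Omega>"
        using p by (intro F) simp
      also have "\<dots> \<le> moment_const p n * (lambda1 \<Omega> powr p * ?I p) / measure lebesgue \<Omega>"
        using m by (intro divide_right_mono moment_iterate p) simp
      also have "\<dots> = moment_const p n * Fp p \<Omega> powr p"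
        by (simp add: F[OF p])
      finally show ?thesis .
    qed
    moreover have "Fp p \<Omega> \<le> 1" if "p \<le> 2"
    proof (rule ccontr)
      assume "\<not> Fp p \<Omega> \<le> 1"
      then have "1 < Fp p \<Omega> powr p"
        using p by (intro gr_one_powr) auto
      moreover have "Fp p \<Omega> powr p \<le> 1"
        unfolding F[OF p] using low_moment_bound[OF p that] m by simp
      ultimately show False by simp
    qed
    ultimately show ?thesis using nonneg by blast
  qed
  then show "0 \<le> Fp p \<Omega>"
    and "Fp (p + real n) \<Omega> powr (p + real n) \<le> moment_const p n * Fp p \<Omega> powr p"
    and "p \<le> 2 \<Longrightarrow> Fp p \<Omega> \<le> 1"
    by simp_all
qed

text \<open>The free bound B serves twice: B = 1 gives explicit uniform bounds from base exponents
  in [1, 2], and B equal to a supremum gives the inequality between suprema.\<close>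

lemma Fp_add_nat_le:
  fixes \<Omega> :: "'a::euclidean_space set"
  assumes \<Omega>: "\<Omega> \<in> sets lebesgue" "0 < emeasure lebesgue \<Omega>" "emeasure lebesgue \<Omega> < \<infinity>"
    and p: "p \<ge> 1" and B: "Fp p \<Omega> \<le> B"
  shows "Fp (p + real n) \<Omega>
    \<le> moment_const p n powr (1 / (p + real n)) * B powr (p / (p + real n))"
proof -
  define q where "q = p + real n"
  have q: "q \<ge> 1" using p by (simp add: q_def)
  have B0: "0 \<le> B"
    using Fp_nonneg[OF \<Omega> p] B by simp
  have "Fp q \<Omega> = (Fp q \<Omega> powr q) powr (1 / q)"
    using Fp_nonneg[OF \<Omega> q] q by (simp add: powr_powr)
  also have "\<dots> \<le> (moment_const p n * B powr p) powr (1 / q)"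
  proof (rule powr_mono2)
    have "Fp q \<Omega> powr q \<le> moment_const p n * Fp p \<Omega> powr p"
      unfolding q_def by (rule Fp_powr_add_nat[OF \<Omega> p])
    also have "\<dots> \<le> moment_const p n * B powr p"
      using p B Fp_nonneg[OF \<Omega> p]
      by (intro mult_left_mono powr_mono2 moment_const_nonneg) auto
    finally show "Fp q \<Omega> powr q \<le> moment_const p n * B powr p" .
  qed (use q in auto)
  also have "\<dots> = moment_const p n powr (1 / q) * B powr (p / q)"
    using moment_const_nonneg[OF p, of n] by (simp add: powr_mult powr_powr)
  finally show ?thesis
    by (simp add: q_def)
qed

lemma Sup_Fp_add_nat_le:
  fixes S :: "'a::euclidean_space set set"
  assumes S: "S \<noteq> {}" "\<And>\<Omega>. \<Omega> \<in> S \<Longrightarrow>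
      \<Omega> \<in> sets lebesgue \<and> 0 < emeasure lebesgue \<Omega> \<and> emeasure lebesgue \<Omega> < \<infinity>"
    and p: "p \<ge> 1"
  shows "(SUP \<Omega>\<in>S. Fp (p + real n) \<Omega>)
    \<le> moment_const p n powr (1 / (p + real n)) * (SUP \<Omega>\<in>S. Fp p \<Omega>) powr (p / (p + real n))"
proof (rule cSUP_least[OF S(1)])
  fix \<Omega> assume "\<Omega> \<in> S"
  \<comment> \<open>A real \<open>Sup\<close> dominates its members only if they are bounded above:
    F_r \<le> 1 for r in [1, 2], and k unit steps turn this into a uniform bound on F_p.\<close>
  obtain r and k :: nat where r: "1 \<le> r" "r \<le> 2" "p = r + real k"
    using real_ge_1_split[OF p] by blast
  have "bdd_above ((\<lambda>\<Omega>. Fp p \<Omega>) ` S)"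
    unfolding r(3) using Fp_add_nat_le[OF _ _ _ r(1) Fp_le_1[OF _ _ _ r(1,2)]] S(2)
    by (intro bdd_aboveI2) blast
  then have "Fp p \<Omega> \<le> (SUP \<Omega>\<in>S. Fp p \<Omega>)"
    using \<open>\<Omega> \<in> S\<close> by (intro cSUP_upper)
  then show "Fp (p + real n) \<Omega>
      \<le> moment_const p n powr (1 / (p + real n)) * (SUP \<Omega>\<in>S. Fp p \<Omega>) powr (p / (p + real n))"
    using S(2)[OF \<open>\<Omega> \<in> S\<close>] p by (intro Fp_add_nat_le) auto
qed

theorem theorem3:
  fixes p :: real and n :: nat
  assumes "DIM('a::euclidean_space) \<ge> 2" and "p \<ge> 1"
  shows "(frakF TYPE('a) (p + real n)
           \<le> ((p + real n) / (4 ^ n * p) * (\<Prod>j=1..n. p + real j)) powr (1 / (p + real n))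
             * frakF TYPE('a) p powr (p / (p + real n)))
       \<and> (frakF_convex TYPE('a) (p + real n)
           \<le> ((p + real n) / (4 ^ n * p) * (\<Prod>j=1..n. p + real j)) powr (1 / (p + real n))
             * frakF_convex TYPE('a) p powr (p / (p + real n)))
       \<and> (p \<le> 2 \<longrightarrow> frakF TYPE('a) (p + 1) \<le> ((p + 1)\<^sup>2 / (4 * p)) powr (1 / (p + 1)))"
proof -
  define S :: "'a set set" where
    "S = {\<Omega>. open \<Omega> \<and> 0 < emeasure lebesgue \<Omega> \<and> emeasure lebesgue \<Omega> < \<infinity>}"
  define C :: "'a set set" where
    "C = {\<Omega>. open \<Omega> \<and> convex \<Omega> \<and> 0 < emeasure lebesgue \<Omega> \<and> emeasure lebesgue \<Omega> < \<infinity>}"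
  have F: "frakF TYPE('a) q = (SUP \<Omega>\<in>S. Fp q \<Omega>)" for q
    unfolding frakF_def S_def by (rule arg_cong[where f=Sup]) auto
  have FC: "frakF_convex TYPE('a) q = (SUP \<Omega>\<in>C. Fp q \<Omega>)" for q
    unfolding frakF_convex_def C_def by (rule arg_cong[where f=Sup]) auto
  have good: "\<Omega> \<in> sets lebesgue \<and> 0 < emeasure lebesgue \<Omega> \<and> emeasure lebesgue \<Omega> < \<infinity>"
    if "\<Omega> \<in> S" for \<Omega>
    using that by (auto simp: S_def)
  have CS: "C \<subseteq> S"
    by (auto simp: C_def S_def)
  \<comment> \<open>The unit ball makes both families nonempty, as \<open>cSUP_least\<close>
    requires.\<close>
  have "ball 0 1 \<in> C"
    by (simp add: C_def emeasure_lborel_ball_finite emeasure_ball)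
  then have ne: "C \<noteq> {}" "S \<noteq> {}"
    using CS by auto
  have 1: "frakF TYPE('a) (p + real n)
      \<le> moment_const p n powr (1 / (p + real n)) * frakF TYPE('a) p powr (p / (p + real n))"
    unfolding F by (rule Sup_Fp_add_nat_le[OF ne(2) good assms(2)])
  have 2: "frakF_convex TYPE('a) (p + real n)
      \<le> moment_const p n powr (1 / (p + real n)) * frakF_convex TYPE('a) p powr (p / (p + real n))"
    unfolding FC using CS good by (intro Sup_Fp_add_nat_le[OF ne(1) _ assms(2)]) blast
  have 3: "frakF TYPE('a) (p + 1) \<le> ((p + 1)\<^sup>2 / (4 * p)) powr (1 / (p + 1))" if "p \<le> 2"
    unfolding F
  proof (rule cSUP_least[OF ne(2)])
    fix \<Omega> assume "\<Omega> \<in> S"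
    note \<Omega> = good[OF this, THEN conjunct1] good[OF this, THEN conjunct2, THEN conjunct1]
      good[OF this, THEN conjunct2, THEN conjunct2]
    \<comment> \<open>A single step, started from the bound B = 1 that holds for p \<le> 2.\<close>
    have "moment_const p 1 = (p + 1)\<^sup>2 / (4 * p)"
      by (simp add: moment_const_def power2_eq_square)
    then show "Fp (p + 1) \<Omega> \<le> ((p + 1)\<^sup>2 / (4 * p)) powr (1 / (p + 1))"
      using Fp_add_nat_le[OF \<Omega> assms(2) Fp_le_1[OF \<Omega> assms(2) that], of 1] by simp
  qed
  show ?thesis
    using 1 2 3 unfolding moment_const_def by blast
qed

end
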